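(* Let $T>0$, $N\ge 1$, and let $L\colon[-T,T]\times\mathbb R^N\times\mathbb R^N\to\mathbb R$ be given by $L(t,x,v)=G(v)+V(t,x)+\langle f(t),x\rangle$. Assume: (A1) $G\colon\mathbb R^N\to[0,\infty)$ is a continuously differentiable G-function satisfying the $\Delta_2$ and $\nabla_2$ conditions; (A2) $V(t,x)=K(t,x)-W(t,x)$ with $K,W\in C^1([-T,T]\times\mathbb R^N,\mathbb R)$; (A3) $a\in L^1([-T,T],\mathbb R)$, $b>1$ and $\rho_0>0$ are such that $V(t,x)\ge b\,G(x)-a(t)$ for $|x|\le\rho_0$, $t\in[-T,T]$; (A4) there exist $b_1>0$ and $p>1$ with $|\cdot|^p\prec G$ such that $\liminf_{|x|\to\infty}\frac{K(t,x)}{|x|^p}\ge b_1$ uniformly in $t\in[-T,T]$ and $\liminf_{|x|\to\infty}\frac{W(t,x)}{\max\{K(t,x),G(x)\}}>3$ uniformly in $t\in[-T,T]$; (A5) there exist $\nu\in\mathbb R$, $\mu>q_G^\infty+\nu$ and $\kappa\in L^1([-T,T],[0,\infty))$ such that $\langle V_x(t,x),x\rangle\le(q_G^\infty+\nu)K(t,x)-\mu W(t,x)+\kappa(t)$ for all $(t,x)\in[-T,T]\times\mathbb R^N$; (A6) $\int_{-T}^TV(t,0)\,dt=0$; (A7) $f\in L^{G^*}([-T,T],\mathbb R^N)$. Let $C$ be an embedding constant for $W^1_TL^G\hookrightarrow L^\infty$ and put $\rho:=\rho_0/C$. Assume moreover that $G$ satisfies $\Delta_2$ and $\nabla_2$ globally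 and that $$R_{G^*}(f)+\int_{-T}^Ta(t)\,dt<\min\{1,b-1\}\cdot\begin{cases}(\rho/2)^{q_G},&\rho\le2,\\(\rho/2)^{p_G},&\rho>2.\end{cases}$$ Then the problem $$\frac{d}{dt}L_v(t,u(t),\dot u(t))=L_x(t,u(t),\dot u(t))\ \text{ for a.e. }t\in[-T,T],\qquad u(-T)=u(T),$$ that is, $\frac{d}{dt}\nabla G(\dot u(t))=V_x(t,u(t))+f(t)$ for a.e. $t$ with $u(-T)=u(T)$, has a (periodic) solution $u\in W^1_TL^G$.
   Context: $|\cdot|$ and $\langle\cdot,\cdot\rangle$ are the Euclidean norm and inner product on $\mathbb R^N$. A G-function is a function $G\colon\mathbb R^N\to[0,\infty)$ that is convex, even, with $G(0)=0$ and $G(x)/|x|\to\infty$ as $|x|\to\infty$. $\Delta_2$: there exist $K_1>2$, $M_1\ge0$ with $G(2x)\le K_1G(x)$ for all $|x|\ge M_1$. $\nabla_2$: there exist $K_2>1$, $M_2\ge0$ with $G(x)\le\frac1{2K_2}G(K_2x)$ for all $|x|\ge M_2$. The condition $\Delta_2$ (resp. $\nabla_2$) holds globally if one can take $M_1=0$ (resp. $M_2=0$). $G_1\prec G_2$ means: there exist $M\ge0$, $k>0$ with $G_1(x)\le G_2(kx)$ for all $|x|\ge M$. Fenchel conjugate: $G^*(y)=\sup_{x\in\mathbb R^N}\{\langle x,y\rangle-G(x)\}$. Modular: $R_G(u)=\int_{-T}^TG(u(t))\,dt$ (and likewise $R_{G^*}$). Simonenko indices: $p_G=\inf_{|x|>0}\frac{\langle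 x,\nabla G(x)\rangle}{G(x)}$, $q_G=\sup_{|x|>0}\frac{\langle x,\nabla G(x)\rangle}{G(x)}$, $q_G^\infty=\limsup_{|x|\to\infty}\frac{\langle x,\nabla G(x)\rangle}{G(x)}$. Orlicz space: $L^G=\{u\colon[-T,T]\to\mathbb R^N\text{ measurable}:\int_{-T}^TG(u)\,dt<\infty\}$ with the Luxemburg norm $\|u\|_{L^G}=\inf\{\lambda>0:\int_{-T}^TG(u/\lambda)\,dt\le1\}$; $L^{G^*}$ is defined in the same way with $G^*$. Orlicz–Sobolev space: $W^1_TL^G=\{u\in L^G:\dot u\in L^G,\ u(-T)=u(T)\}$ ($u$ absolutely continuous with weak derivative $\dot u$), with norm $\|u\|_{W^1L^G}=\|u\|_{L^G}+\|\dot u\|_{L^G}$. An embedding constant for $W^1_TL^G\hookrightarrow L^\infty$ is a constant $C>0$ with $\|u\|_{L^\infty}\le C\|u\|_{W^1L^G}$ for all $u\in W^1_TL^G$. "$\liminf_{|x|\to\infty}W/\max\{K,G\}>3$ uniformly in $t$" means: there are $\varepsilon_0,r>0$ with $W(t,x)\ge(3+\varepsilon_0)\max\{K(t,x),G(x)\}$ for all $|x|>r$ and all $t$; "$\liminf_{|x|\to\infty} K/|x|^p\ge b_1$ uniformly in $t$" means: for every $\varepsilon>0$ there is $r>0$ with $K(t,x)\ge(b_1-\varepsilon)|x|^p$ for all $|x|>r$ and all $t$. A solution is a function $u\in W^1_TL^G$ such that $t\mapsto\nabla G(\dot u(t))$ agrees a.e. with an absolutely continuous function whose derivative equals $V_x(t,u(t))+f(t)$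 for a.e. $t\in[-T,T]$. *)

theory Defs
  imports "HOL-Analysis.Analysis" "HOL-Probability.Essential_Supremum"
begin

section \<open>Gradients and continuous differentiability\<close>

definition gradient :: "('a::real_inner \<Rightarrow> real) \<Rightarrow> 'a \<Rightarrow> 'a" where
  "gradient f x = (THE D. GDERIV f x :> D)"

text \<open>On \<open>{-T..T} \<times> UNIV\<close> with \<open>T > 0\<close> the derivative within the set is unique (it is
  one-sided in time at the two end points).\<close>

definition C1_on :: "'a::real_normed_vector set \<Rightarrow> ('a \<Rightarrow> 'b::real_normed_vector) \<Rightarrow> bool" where
  "C1_on S f \<longleftrightarrow> (\<exists>D :: 'a \<Rightarrow> ('a \<Rightarrow>\<^sub>L 'b). continuous_on S D \<and>
     (\<forall>x\<in>S. (f has_derivative blinfun_apply (D x)) (at x within S)))"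

section \<open>G-functions\<close>

definition G_function :: "('a::euclidean_space \<Rightarrow> real) \<Rightarrow> bool" where
  "G_function G \<longleftrightarrow> (\<forall>x. G x \<ge> 0) \<and> convex_on UNIV G \<and> (\<forall>x. G (- x) = G x) \<and> G 0 = 0 \<and>
     filterlim (\<lambda>x. G x / norm x) at_top at_infinity"

definition Delta2_from :: "real \<Rightarrow> ('a::real_normed_vector \<Rightarrow> real) \<Rightarrow> bool" where
  "Delta2_from M G \<longleftrightarrow> (\<exists>K>2. \<forall>x. norm x \<ge> M \<longrightarrow> G (2 *\<^sub>R x) \<le> K * G x)"

definition Nabla2_from :: "real \<Rightarrow> ('a::real_normed_vector \<Rightarrow> real) \<Rightarrow> bool" where
  "Nabla2_from M G \<longleftrightarrow> (\<exists>K>1. \<forall>x. norm x \<ge> M \<longrightarrow> G x \<le> 1 / (2 * K) * G (K *\<^sub>R x))"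

definition Delta2 :: "('a::real_normed_vector \<Rightarrow> real) \<Rightarrow> bool" where
  "Delta2 G \<longleftrightarrow> (\<exists>M\<ge>0. Delta2_from M G)"

definition Nabla2 :: "('a::real_normed_vector \<Rightarrow> real) \<Rightarrow> bool" where
  "Nabla2 G \<longleftrightarrow> (\<exists>M\<ge>0. Nabla2_from M G)"

definition Delta2_global :: "('a::real_normed_vector \<Rightarrow> real) \<Rightarrow> bool" where
  "Delta2_global G \<longleftrightarrow> Delta2_from 0 G"

definition Nabla2_global :: "('a::real_normed_vector \<Rightarrow> real) \<Rightarrow> bool" where
  "Nabla2_global G \<longleftrightarrow> Nabla2_from 0 G"

definition G_prec :: "('a::real_normed_vector \<Rightarrow> real) \<Rightarrow> ('a \<Rightarrow> real) \<Rightarrow> bool" (infix \<open>\<prec>\<^sub>G\<close> 50) where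
  "G1 \<prec>\<^sub>G G2 \<longleftrightarrow> (\<exists>M\<ge>0. \<exists>k>0. \<forall>x. norm x \<ge> M \<longrightarrow> G1 x \<le> G2 (k *\<^sub>R x))"

text \<open>For a G-function the supremum is finite, because of the superlinear growth.\<close>

definition fenchel_conjugate :: "('a::real_inner \<Rightarrow> real) \<Rightarrow> 'a \<Rightarrow> real" where
  "fenchel_conjugate G y = (SUP x. inner x y - G x)"

text \<open>For a differentiable G-function that satisfies \<open>\<Delta>\<^sub>2\<close> globally with constant \<open>K\<close>, \<open>G\<close> is
  positive off the origin and convexity gives
  \<open>G x \<le> inner x (gradient G x) \<le> (K - 1) * G x\<close>, so the infimum and the supremum below are
  those of a bounded set and the limit superior is finite.\<close>

definition simonenko_quotient :: "('a::real_inner \<Rightarrow> real) \<Rightarrow> 'a \<Rightarrow> real" where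
  "simonenko_quotient G x = inner x (gradient G x) / G x"

definition p_index :: "('a::real_inner \<Rightarrow> real) \<Rightarrow> real" where
  "p_index G = (INF x\<in>{x. norm x > 0}. simonenko_quotient G x)"

definition q_index :: "('a::real_inner \<Rightarrow> real) \<Rightarrow> real" where
  "q_index G = (SUP x\<in>{x. norm x > 0}. simonenko_quotient G x)"

definition q_index_inf :: "('a::real_inner \<Rightarrow> real) \<Rightarrow> real" where
  "q_index_inf G = real_of_ereal (Limsup at_infinity (\<lambda>x. ereal (simonenko_quotient G x)))"

section \<open>Orlicz and Orlicz--Sobolev spaces on \<open>[-T, T]\<close>\<close>

text \<open>Functions on \<open>[-T, T]\<close> are total functions on the reals of which only the values on
  \<open>{-T..T}\<close> matter.  Finiteness of a modular is expressed by the Lebesgue integral with values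
  in the extended nonnegative reals, since the Bochner integral of a non-integrable function
  is 0.\<close>

definition modular :: "real \<Rightarrow> ('a::euclidean_space \<Rightarrow> real) \<Rightarrow> (real \<Rightarrow> 'a) \<Rightarrow> real" where
  "modular T G u = (LINT t|lebesgue_on {-T..T}. G (u t))"

definition orlicz_space :: "real \<Rightarrow> ('a::euclidean_space \<Rightarrow> real) \<Rightarrow> (real \<Rightarrow> 'a) set" where
  "orlicz_space T G = {u. u \<in> borel_measurable (lebesgue_on {-T..T}) \<and>
     (\<integral>\<^sup>+ t. ennreal (G (u t)) \<partial>lebesgue_on {-T..T}) < \<infinity>}"

definition luxemburg_norm :: "real \<Rightarrow> ('a::euclidean_space \<Rightarrow> real) \<Rightarrow> (real \<Rightarrow> 'a) \<Rightarrow> real" where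
  "luxemburg_norm T G u =
     Inf {l. l > 0 \<and> (\<integral>\<^sup>+ t. ennreal (G (u t /\<^sub>R l)) \<partial>lebesgue_on {-T..T}) \<le> 1}"

text \<open>Absolute continuity of a function on a compact interval; \<open>I\<close> is a finite set of
  (end point pairs of) non-overlapping subintervals.\<close>

definition abs_continuous_on :: "real \<Rightarrow> real \<Rightarrow> (real \<Rightarrow> 'a::real_normed_vector) \<Rightarrow> bool" where
  "abs_continuous_on a b u \<longleftrightarrow> (\<forall>\<epsilon>>0. \<exists>\<delta>>0. \<forall>I :: (real \<times> real) set.
     finite I \<and> (\<forall>(x, y)\<in>I. a \<le> x \<and> x \<le> y \<and> y \<le> b) \<and>
     disjoint_family_on (\<lambda>(x, y). {x<..<y}) I \<and> (\<Sum>(x, y)\<in>I. y - x) < \<delta> \<longrightarrow>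
     (\<Sum>(x, y)\<in>I. norm (u y - u x)) < \<epsilon>)"

text \<open>An absolutely continuous function is differentiable almost everywhere, and its almost
  everywhere derivative is its weak derivative.  The values of \<open>vel u\<close> at the remaining
  points (and at the end points) are irrelevant.\<close>

definition vel :: "(real \<Rightarrow> 'a::real_normed_vector) \<Rightarrow> real \<Rightarrow> 'a" where
  "vel u t = vector_derivative u (at t)"

definition orlicz_sobolev :: "real \<Rightarrow> ('a::euclidean_space \<Rightarrow> real) \<Rightarrow> (real \<Rightarrow> 'a) set" where
  "orlicz_sobolev T G = {u. u \<in> orlicz_space T G \<and> abs_continuous_on (-T) T u \<and>
     vel u \<in> orlicz_space T G \<and> u (-T) = u T}"

definition orlicz_sobolev_norm :: "real \<Rightarrow> ('a::euclidean_space \<Rightarrow> real) \<Rightarrow> (real \<Rightarrow> 'a) \<Rightarrow> real" where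
  "orlicz_sobolev_norm T G u = luxemburg_norm T G u + luxemburg_norm T G (vel u)"

definition embedding_constant :: "real \<Rightarrow> ('a::euclidean_space \<Rightarrow> real) \<Rightarrow> real \<Rightarrow> bool" where
  "embedding_constant T G C \<longleftrightarrow> C > 0 \<and> (\<forall>u\<in>orlicz_sobolev T G.
     esssup (lebesgue_on {-T..T}) (\<lambda>t. ereal (norm (u t))) \<le> ereal (C * orlicz_sobolev_norm T G u))"

text \<open>\<open>d/dt A(t) = B(t)\<close> for almost every \<open>t\<close>, where \<open>A\<close> is identified with an
  absolutely continuous representative.\<close>

definition ae_time_derivative ::
    "real \<Rightarrow> (real \<Rightarrow> 'a::real_normed_vector) \<Rightarrow> (real \<Rightarrow> 'a) \<Rightarrow> bool" where
  "ae_time_derivative T A B \<longleftrightarrow> (\<exists>w. abs_continuous_on (-T) T w \<and>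
     (AE t in lebesgue_on {-T..T}. A t = w t) \<and>
     (AE t in lebesgue_on {-T..T}. (w has_vector_derivative B t) (at t)))"

end

theory Submission
  imports Defs "HOL-Complex_Analysis.Great_Picard"
begin

text \<open>No mountain pass is needed.  Let \<open>c\<close> be the power of \<open>\<rho> / 2\<close> in the smallness condition.
  If \<open>R\<^sub>G(u) + R\<^sub>G(u') \<le> c\<close> then the Simonenko indices bound both Luxemburg norms by \<open>\<rho> / 2\<close>, so
  \<open>|u| \<le> \<rho>\<^sub>0\<close>, and (A3) with Young's inequality for \<open>G\<close> and \<open>G\<^sup>*\<close> gives
  \<open>J(u) \<ge> min {1, b - 1} (R\<^sub>G(u) + R\<^sub>G(u')) - R\<^sub>G\<^sub>*(f) - \<integral> a\<close>
  for the action \<open>J\<close>.  Hence \<open>J\<close> has a minimiser on this set, and since \<open>J(0) = 0\<close> by (A6), the smallness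
  condition forces it to satisfy \<open>R\<^sub>G(u) + R\<^sub>G(u') < c\<close>.  The constraint is therefore inactive and
  the minimiser solves the Euler--Lagrange equation.

  Minimising sequences converge uniformly by Arzela--Ascoli; a limit of the velocities is found by
  strict convexity instead of weak compactness.\<close>

section \<open>Indefinite integrals\<close>

text \<open>The obstacle is the velocity. The potential sees only the curve, and bounded energy
  makes curves equicontinuous, so the potential term converges although \<open>V\<close> is not
  convex. Velocities of a minimising sequence may oscillate; for them only lower semicontinuity of
  the modular is available, which is all that minimisation asks. Curves are stored as a starting
  point \<open>x\<close> and a velocity \<open>g\<close>, so that absolute continuity and the almost
  everywhere derivative become facts about indefinite integrals. The constraint bounds modulars and
  not norms because modulars are convex, pass to limits by Fatou and are what integrating (A3)
  produces. The exponents in \<open>c\<close> come from dilation by \<open>2 / \<rho>\<close>, which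
  multiplies \<open>G\<close> by at most \<open>1 / c\<close>: \<open>q_index G\<close> governs
  enlarging, \<open>p_index G\<close> governs shrinking. Once the constraint is inactive, bounded
  zero-mean variations of \<open>g\<close> and free variations of \<open>x\<close> suffice:
  convexity keeps small steps admissible without any continuity of the energy, and the decisive test
  direction is a sign field, which is bounded.\<close>

lemma AE_lebesgue_on_negligibleI:
  assumes "negligible N" "\<And>t. t \<in> {a..b} \<Longrightarrow> t \<notin> N \<Longrightarrow> P t"
  shows "AE t in lebesgue_on {a..b::real}. P t"
proof -
  have "AE t in lebesgue. t \<notin> N"
    using assms(1) negligible_iff_null_sets AE_not_in by blast
  then show ?thesis
    by (subst AE_restrict_space_iff) (auto elim!: eventually_mono intro: assms(2))
qed

text \<open>Completeness of Lebesgue measure. It is needed because the velocity of a curve is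
  identified only almost everywhere.\<close>

lemma borel_measurable_lebesgue_on_AE_cong:
  fixes g h :: "real \<Rightarrow> 'a::euclidean_space"
  assumes "g \<in> borel_measurable (lebesgue_on {a..b})" "AE t in lebesgue_on {a..b}. h t = g t"
  shows "h \<in> borel_measurable (lebesgue_on {a..b})"
proof -
  from assms(2) have "AE t in lebesgue. t \<in> {a..b} \<longrightarrow> h t = g t"
    by (subst (asm) AE_restrict_space_iff) auto
  then obtain N where N: "N \<in> null_sets lebesgue" "{t. \<not> (t \<in> {a..b} \<longrightarrow> h t = g t)} \<subseteq> N"
    by (auto simp: eventually_ae_filter)
  then have N: "negligible N" "\<And>t. t \<in> {a..b} - N \<Longrightarrow> h t = g t"
    by (auto simp: negligible_iff_null_sets)
  have "g measurable_on {a..b}"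
    using assms(1) by (simp add: measurable_on_iff_borel_measurable)
  then have "h measurable_on {a..b}"
    by (rule measurable_on_spike[OF _ N])
  then show ?thesis
    by (simp add: measurable_on_iff_borel_measurable)
qed

lemma integral_lebesgue_on_atLeastAtMost:
  fixes g :: "real \<Rightarrow> 'a::euclidean_space"
  assumes "integrable (lebesgue_on {a..b}) g"
  shows "integral\<^sup>L (lebesgue_on {a..b}) g = integral {a..b} g"
  using assms by (intro lebesgue_integral_eq_integral) auto

lemma integral_from_diff:
  fixes g :: "real \<Rightarrow> 'a::euclidean_space"
  assumes "integrable (lebesgue_on {a..b}) g" "a \<le> x" "x \<le> y" "y \<le> b"
  shows "integral {a..y} g - integral {a..x} g = integral {x..y} g"
proof -
  have "g integrable_on {a..y}"
    using assms integrable_on_lebesgue_on[OF integrable_subinterval[OF assms(1), of a y]] by auto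
  then show ?thesis
    using Henstock_Kurzweil_Integration.integral_combine[of a x y g] assms by (simp add: algebra_simps)
qed

text \<open>Dominated convergence with \<open>k\<close> itself as majorant, the truncation level
  running through the naturals. A single integrable function is thus uniformly integrable.\<close>

lemma integral_excess_small:
  fixes k :: "'a \<Rightarrow> real"
  assumes "integrable M k" "\<And>t. k t \<ge> 0" "e > 0"
  obtains A where "A \<ge> 0" "integral\<^sup>L M (\<lambda>t. max 0 (k t - A)) < e"
proof -
  have "(\<lambda>n. integral\<^sup>L M (\<lambda>t. max 0 (k t - real n))) \<longlonglongrightarrow> integral\<^sup>L M (\<lambda>t. 0)"
  proof (rule integral_dominated_convergence[where w=k])
    show "AE x in M. (\<lambda>i. max 0 (k x - real i)) \<longlonglongrightarrow> 0"
    proof (rule AE_I2)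
      fix x
      have "eventually (\<lambda>i. max 0 (k x - real i) = 0) sequentially"
        using eventually_ge_at_top[of "nat \<lceil>k x\<rceil>"] by eventually_elim (auto simp: nat_ceiling_le_eq max_def)
      then show "(\<lambda>i. max 0 (k x - real i)) \<longlonglongrightarrow> 0"
        by (rule tendsto_eventually)
    qed
  qed (use assms in \<open>auto\<close>)
  then have "eventually (\<lambda>n. integral\<^sup>L M (\<lambda>t. max 0 (k t - real n)) < e) sequentially"
    using assms(3) by (intro order_tendstoD) auto
  then obtain n where "integral\<^sup>L M (\<lambda>t. max 0 (k t - real n)) < e"
    by (auto simp: eventually_sequentially)
  then show ?thesis
    by (intro that[of "real n"]) auto
qed

text \<open>The norm of the integrand is at most \<open>A\<close> plus its excess over
  \<open>A\<close>. The first part costs \<open>A\<close> times the total length; the second costs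
  less than \<open>e / 2\<close> whatever the intervals, since they do not overlap.\<close>

lemma abs_continuous_on_integral:
  fixes g :: "real \<Rightarrow> 'a::euclidean_space"
  assumes g: "integrable (lebesgue_on {a..b}) g"
  shows "abs_continuous_on a b (\<lambda>t. x0 + integral {a..t} g)"
  unfolding abs_continuous_on_def
proof (intro allI impI)
  fix e :: real assume "e > 0"
  let ?M = "lebesgue_on {a..b}"
  obtain A where A: "A \<ge> 0" "integral\<^sup>L ?M (\<lambda>t. max 0 (norm (g t) - A)) < e / 2"
    using integral_excess_small[of ?M "\<lambda>t. norm (g t)" "e/2"] g \<open>e > 0\<close> by auto
  show "\<exists>\<delta>>0. \<forall>I. finite I \<and> (\<forall>(x, y)\<in>I. a \<le> x \<and> x \<le> y \<and> y \<le> b) \<and>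
     disjoint_family_on (\<lambda>(x, y). {x<..<y}) I \<and> (\<Sum>(x, y)\<in>I. y - x) < \<delta> \<longrightarrow>
     (\<Sum>(x, y)\<in>I. norm (x0 + integral {a..y} g - (x0 + integral {a..x} g))) < e"
  proof (intro exI[of _ "e / (2 * (A + 1))"] conjI allI impI; (elim conjE)?)
    show "0 < e / (2 * (A + 1))"
      using \<open>e > 0\<close> A by auto
  next
    fix I :: "(real \<times> real) set"
    assume fin: "finite I" and I: "\<forall>(x, y)\<in>I. a \<le> x \<and> x \<le> y \<and> y \<le> b"
      and dis: "disjoint_family_on (\<lambda>(x, y). {x<..<y}) I" and len: "(\<Sum>(x, y)\<in>I. y - x) < e / (2 * (A + 1))"
    let ?E = "\<lambda>t. max 0 (norm (g t) - A)"
    have iE: "integrable ?M ?E"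
      using g by auto
    \<comment> \<open>Open intervals, because only these are assumed disjoint: neighbours in
      \<open>I\<close> may share an end point, and a degenerate pair contributes the empty
      set.\<close>
    have ind: "(\<lambda>t. indicator {x<..<y} t :: real) \<in> borel_measurable ?M" for x y
      by (intro borel_measurable_indicator' measurable_restrict_space1) auto
    have iEI: "integrable ?M (\<lambda>t. indicator {x<..<y} t * ?E t)" for x y
      by (rule Bochner_Integration.integrable_bound[OF iE]) (use ind g in \<open>auto simp: indicator_def\<close>)
    have one: "norm (integral {x..y} g) \<le> A * (y - x) + integral\<^sup>L ?M (\<lambda>t. indicator {x<..<y} t * ?E t)"
      if "a \<le> x" "x \<le> y" "y \<le> b" for x y
    proof -
      have i: "integrable (lebesgue_on {x..y}) g"
        using that by (intro integrable_subinterval[OF g]) auto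
      have "norm (integral {x..y} g) \<le> integral\<^sup>L (lebesgue_on {x..y}) (\<lambda>t. norm (g t))"
        using i by (metis integral_lebesgue_on_atLeastAtMost integral_norm_bound)
      also have "\<dots> \<le> integral\<^sup>L (lebesgue_on {x..y}) (\<lambda>t. A + ?E t)"
        using i by (intro integral_mono) auto
      also have "\<dots> = A * (y - x) + integral\<^sup>L (lebesgue_on {x..y}) ?E"
        using i that by (subst Bochner_Integration.integral_add) (auto simp: measure_restrict_space)
      also have "integral\<^sup>L (lebesgue_on {x..y}) ?E = integral\<^sup>L (lebesgue_on {a..b}) (\<lambda>t. if t \<in> {x..y} then ?E t else 0)"
        using that by (intro Lebesgue_Measure.integral_restrict[symmetric]) auto
      also have "\<dots> = integral\<^sup>L ?M (\<lambda>t. indicator {x<..<y} t * ?E t)"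
      proof (rule integral_cong_AE)
        show "(\<lambda>t. if t \<in> {x..y} then ?E t else 0) \<in> borel_measurable ?M"
          using i that by (subst borel_measurable_if_lebesgue_on) auto
        show "AE t in ?M. (if t \<in> {x..y} then ?E t else 0) = indicator {x<..<y} t * ?E t"
          by (rule AE_lebesgue_on_negligibleI[of "{x,y}"]) (auto simp: indicator_def)
      qed (use iEI in auto)
      finally show ?thesis .
    qed
    have "(\<Sum>(x, y)\<in>I. norm (x0 + integral {a..y} g - (x0 + integral {a..x} g)))
        = (\<Sum>(x, y)\<in>I. norm (integral {x..y} g))"
      using I integral_from_diff[OF g] by (intro sum.cong) auto
    also have "\<dots> \<le> (\<Sum>(x, y)\<in>I. A * (y - x) + integral\<^sup>L ?M (\<lambda>t. indicator {x<..<y} t * ?E t))"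
      using I one by (intro sum_mono) auto
    also have "\<dots> = A * (\<Sum>(x, y)\<in>I. y - x) + (\<Sum>(x, y)\<in>I. integral\<^sup>L ?M (\<lambda>t. indicator {x<..<y} t * ?E t))"
      by (simp add: sum.distrib sum_distrib_left case_prod_unfold)
    also have "(\<Sum>(x, y)\<in>I. integral\<^sup>L ?M (\<lambda>t. indicator {x<..<y} t * ?E t))
        = integral\<^sup>L ?M (\<lambda>t. \<Sum>(x, y)\<in>I. indicator {x<..<y} t * ?E t)"
      using iEI by (subst Bochner_Integration.integral_sum) (auto simp: case_prod_unfold)
    also have "\<dots> \<le> integral\<^sup>L ?M ?E"
    proof (rule integral_mono)
      show "integrable ?M (\<lambda>t. \<Sum>(x, y)\<in>I. indicator {x<..<y} t * ?E t)"
        using iEI by (auto simp: case_prod_unfold)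
      fix t
      have "(\<Sum>(x, y)\<in>I. indicator {x<..<y} t * ?E t) = (\<Sum>i\<in>I. indicator ((\<lambda>(x,y). {x<..<y}) i) t) * ?E t"
        by (simp add: sum_distrib_right case_prod_unfold)
      also have "(\<Sum>i\<in>I. indicator ((\<lambda>(x,y). {x<..<y}) i) t) = (indicator (\<Union>i\<in>I. (\<lambda>(x,y). {x<..<y}) i) t :: real)"
        using dis fin by (intro indicator_UN_disjoint[symmetric])
      also have "\<dots> * ?E t \<le> ?E t"
        by (auto simp: indicator_def)
      finally show "(\<Sum>(x, y)\<in>I. indicator {x<..<y} t * ?E t) \<le> ?E t" .
    qed (use iE in auto)
    also have "\<dots> < e / 2" by fact
    also have "A * (\<Sum>(x, y)\<in>I. y - x) \<le> A * (e / (2 * (A + 1)))"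
      using len A by (intro mult_left_mono) auto
    also have "\<dots> \<le> e / 2"
      using A \<open>e > 0\<close> by (simp add: field_simps)
    finally show "(\<Sum>(x, y)\<in>I. norm (x0 + integral {a..y} g - (x0 + integral {a..x} g))) < e"
      by simp
  qed
qed

text \<open>\<open>integrable_ccontinuous_explicit\<close> averages over cubes whose lower corner is
  the point, so in dimension one it yields the derivative from the right.\<close>

lemma right_difference_quotient_AE:
  fixes g :: "real \<Rightarrow> 'a::euclidean_space"
  assumes "\<And>a b. g integrable_on {a..b}"
  obtains N where "negligible N"
    "\<And>t. t \<notin> N \<Longrightarrow> ((\<lambda>h. integral {t..t+h} g /\<^sub>R h) \<longlongrightarrow> g t) (at_right 0)"
proof -
  obtain N where N: "negligible N"
       "\<And>x e. \<lbrakk>x \<notin> N; 0 < e\<rbrakk> \<Longrightarrow> \<exists>d>0. \<forall>h. 0 < h \<and> h < d \<longrightarrow>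
           norm(integral (cbox x (x + h *\<^sub>R One)) g /\<^sub>R h ^ DIM(real) - g x) < e"
    using integrable_ccontinuous_explicit[of g] assms by (metis cbox_interval)
  show ?thesis
  proof (rule that[OF N(1)])
    fix t assume "t \<notin> N"
    show "((\<lambda>h. integral {t..t+h} g /\<^sub>R h) \<longlongrightarrow> g t) (at_right 0)"
      unfolding tendsto_iff eventually_at_right_field dist_norm
      using N(2)[OF \<open>t \<notin> N\<close>] by (fastforce simp: cbox_interval)
  qed
qed

text \<open>The available averages start at the point, so the derivative from the left is read off
  the reflected function. The exceptional set collects one null set, the mirror image of another and
  the two end points.\<close>

lemma has_vector_derivative_integral_AE:
  fixes g :: "real \<Rightarrow> 'a::euclidean_space"
  assumes g: "integrable (lebesgue_on {a..b}) g"
  shows "AE t in lebesgue_on {a..b}. ((\<lambda>t. x0 + integral {a..t} g) has_vector_derivative g t) (at t)"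
proof -
  \<comment> \<open>Extension by zero gives integrability on every interval, as the quotient lemma
    requires, and leaves the primitive unchanged inside \<open>{a..b}\<close>.\<close>
  define k where "k = (\<lambda>t. if t \<in> {a..b} then g t else 0)"
  have gi: "g integrable_on {a..b}"
    using g by (intro integrable_on_lebesgue_on) auto
  then have kU: "k integrable_on UNIV"
    unfolding k_def using integrable_restrict_UNIV[of "{a..b}" g] by blast
  then have k: "k integrable_on {c..d}" for c d
    by (rule integrable_on_subinterval) auto
  have k': "(\<lambda>t. k (- t)) integrable_on {c..d}" for c d
    using k[of "-d" "-c"] Henstock_Kurzweil_Integration.integrable_reflect_real[where f=k and a="-d" and b="-c"] by simp
  obtain N1 where N1: "negligible N1"
    "\<And>t. t \<notin> N1 \<Longrightarrow> ((\<lambda>h. integral {t..t+h} k /\<^sub>R h) \<longlongrightarrow> k t) (at_right 0)"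
    using right_difference_quotient_AE[of k] k by blast
  obtain N2 where N2: "negligible N2"
    "\<And>t. t \<notin> N2 \<Longrightarrow> ((\<lambda>h. integral {t..t+h} (\<lambda>t. k (- t)) /\<^sub>R h) \<longlongrightarrow> k (- t)) (at_right 0)"
    using right_difference_quotient_AE[of "\<lambda>t. k (- t)"] k' by blast
  have neg: "negligible (uminus ` N2)"
    using N2(1) by (intro negligible_differentiable_image_negligible) (auto intro!: derivative_intros simp: differentiable_on_def)
  show ?thesis
  proof (rule AE_lebesgue_on_negligibleI[of "{a,b} \<union> N1 \<union> uminus ` N2"])
    show "negligible ({a, b} \<union> N1 \<union> uminus ` N2)"
      using N1 neg by auto
    fix t assume t: "t \<in> {a..b}" "t \<notin> {a, b} \<union> N1 \<union> uminus ` N2"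
    then have ab: "t \<in> {a<..<b}" "- t \<notin> N2"
      by (auto simp: image_iff)
    let ?u = "\<lambda>t. integral {a..t} k"
    have eq1: "integral {t..t+h} k /\<^sub>R h = (?u (t + h) - ?u t) /\<^sub>R h" if "h > 0" for h
    proof -
      have "integral {t..t+h} k = ?u (t + h) - ?u t"
        using Henstock_Kurzweil_Integration.integral_combine[of a t "t+h" k] k ab that by (simp add: algebra_simps)
      then show ?thesis by simp
    qed
    have eq2: "integral {-t..-t+h} (\<lambda>t. k (- t)) /\<^sub>R h = (?u (t - h) - ?u t) /\<^sub>R (- h)" if "h > 0" "h < t - a" for h
    proof -
      have "integral {-t..-t+h} (\<lambda>t. k (- t)) = integral {t-h..t} k"
        using Henstock_Kurzweil_Integration.integral_reflect_real[where f=k and a="t-h" and b=t] by simp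
      also have "\<dots> = ?u t - ?u (t - h)"
        using Henstock_Kurzweil_Integration.integral_combine[of a "t-h" "t" k] k ab that by (simp add: algebra_simps)
      finally have "integral {-t..-t+h} (\<lambda>t. k (- t)) = - (?u (t - h) - ?u t)"
        by simp
      then show ?thesis
        by (simp only: inverse_minus_eq scaleR_minus_left scaleR_minus_right)
    qed
    have kt: "k t = g t" using t by (auto simp: k_def)
    have R: "((\<lambda>h. (?u (t + h) - ?u t) /\<^sub>R h) \<longlongrightarrow> g t) (at_right 0)"
    proof (rule Lim_transform_eventually)
      show "((\<lambda>h. integral {t..t+h} k /\<^sub>R h) \<longlongrightarrow> g t) (at_right 0)"
        using N1(2)[of t] t kt by auto
      show "\<forall>\<^sub>F h in at_right 0. integral {t..t+h} k /\<^sub>R h = (?u (t + h) - ?u t) /\<^sub>R h"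
        unfolding eventually_at_right_field by (metis eq1 zero_less_one)
    qed
    have L0: "((\<lambda>h. (?u (t - h) - ?u t) /\<^sub>R (- h)) \<longlongrightarrow> g t) (at_right 0)"
    proof (rule Lim_transform_eventually)
      show "((\<lambda>h. integral {-t..-t+h} (\<lambda>t. k (- t)) /\<^sub>R h) \<longlongrightarrow> g t) (at_right 0)"
        using N2(2)[of "- t"] ab kt by auto
      have "t - a > 0" using ab by auto
      then show "\<forall>\<^sub>F h in at_right 0. integral {-t..-t+h} (\<lambda>t. k (- t)) /\<^sub>R h = (?u (t - h) - ?u t) /\<^sub>R (- h)"
        unfolding eventually_at_right_field by (metis eq2)
    qed
    have L: "((\<lambda>h. (?u (t + h) - ?u t) /\<^sub>R h) \<longlongrightarrow> g t) (at_left 0)"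
      using L0 by (subst at_left_minus) (simp add: filterlim_filtermap)
    have "((\<lambda>h. (?u (t + h) - ?u t) /\<^sub>R h) \<longlongrightarrow> g t) (at 0)"
      using L R filterlim_split_at by blast
    then have "(?u has_vector_derivative g t) (at t)"
      unfolding has_vector_derivative_def has_derivative_at
    proof (intro conjI bounded_linear_scaleR_left)
      assume "((\<lambda>h. (?u (t + h) - ?u t) /\<^sub>R h) \<longlongrightarrow> g t) (at 0)"
      then have "((\<lambda>h. norm ((?u (t + h) - ?u t) /\<^sub>R h - g t)) \<longlongrightarrow> 0) (at 0)"
        by (intro tendsto_norm_zero LIM_zero)
      then show "((\<lambda>h. norm (?u (t + h) - ?u t - h *\<^sub>R g t) / norm h) \<longlongrightarrow> 0) (at 0)"
      proof (rule Lim_transform_eventually)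
        have "norm ((?u (t + h) - ?u t) /\<^sub>R h - g t) = norm (?u (t + h) - ?u t - h *\<^sub>R g t) / norm h"
          if "h \<noteq> 0" for h
        proof -
          have "(?u (t + h) - ?u t) /\<^sub>R h - g t = (?u (t + h) - ?u t - h *\<^sub>R g t) /\<^sub>R h"
            using that by (simp add: algebra_simps)
          then show ?thesis
            by (simp add: divide_inverse_commute)
        qed
        then show "\<forall>\<^sub>F h in at 0. norm ((?u (t + h) - ?u t) /\<^sub>R h - g t)
            = norm (?u (t + h) - ?u t - h *\<^sub>R g t) / norm h"
          by (auto simp: eventually_at intro!: exI[of _ 1])
      qed
    qed
    then have "((\<lambda>t. x0 + ?u t) has_vector_derivative g t) (at t)"
      by (auto intro!: derivative_eq_intros)
    then show "((\<lambda>t. x0 + integral {a..t} g) has_vector_derivative g t) (at t)"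
    proof (rule has_vector_derivative_transform_within_open[where S="{a<..<b}"])
      fix s assume "s \<in> {a<..<b}"
      then show "x0 + integral {a..s} k = x0 + integral {a..s} g"
        by (auto simp: k_def intro!: integral_cong)
    qed (use ab in auto)
  qed
qed

section \<open>Strong compactness in \<open>L\<^sup>1\<close> from strict convexity\<close>

text \<open>A strictly convex function of linear growth, hence with finite integral along every
  integrable velocity; a square would demand square integrability. \<open>G\<close> is only assumed
  convex and cannot supply the strictness.\<close>

abbreviation japanese_bracket :: "'a::real_inner \<Rightarrow> real" where
  "japanese_bracket x \<equiv> sqrt (1 + (norm x)\<^sup>2)"

lemma japanese_bracket_le: "japanese_bracket x \<le> 1 + norm x"
  by (rule real_le_lsqrt) (auto simp: power2_eq_square algebra_simps)

text \<open>Two differences of squares are factorised: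
  \<open>(hx * hy)\<^sup>2 - (1 + s)\<^sup>2\<close>, which dominates the squared distance by
  Cauchy-Schwarz, and \<open>((hx + hy) / 2)\<^sup>2 - hm\<^sup>2\<close>, which equals half of
  \<open>hx * hy - (1 + s)\<close>. The factors \<open>2\<close>, \<open>4 * (1 + A)\<close> and
  \<open>(1 + A)\<^sup>2\<close> met on the way multiply to the constant.\<close>

lemma japanese_bracket_midpoint_gap:
  fixes x y :: "'a::real_inner"
  assumes "norm x \<le> A" "norm y \<le> A"
  shows "(norm (x - y))\<^sup>2 \<le> 8 * (1 + A) ^ 3 *
    (japanese_bracket x / 2 + japanese_bracket y / 2 - japanese_bracket ((x + y) /\<^sub>R 2))"
proof -
  define hx hy hm s where defs: "hx = japanese_bracket x" "hy = japanese_bracket y"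
    "hm = japanese_bracket ((x + y) /\<^sub>R 2)" "s = inner x y"
  have A: "A \<ge> 0" using assms norm_ge_zero order_trans by blast
  have h1: "hx \<ge> 1" "hy \<ge> 1" "hm \<ge> 1" "hx \<le> 1 + A" "hy \<le> 1 + A"
    using assms japanese_bracket_le[of x] japanese_bracket_le[of y] unfolding defs by auto
  have sq: "hx\<^sup>2 = 1 + (norm x)\<^sup>2" "hy\<^sup>2 = 1 + (norm y)\<^sup>2"
    unfolding defs by auto
  have "(norm (x + y))\<^sup>2 = (norm x)\<^sup>2 + (norm y)\<^sup>2 + 2 * s"
    unfolding defs by (simp add: power2_norm_eq_inner algebra_simps inner_commute)
  then have sqm: "hm\<^sup>2 = 1 + ((norm x)\<^sup>2 + (norm y)\<^sup>2 + 2 * s) / 4"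
    using zero_le_power2[of "norm (x + y)"] unfolding defs by (simp add: power_divide)
  have d: "(norm (x - y))\<^sup>2 = (norm x)\<^sup>2 + (norm y)\<^sup>2 - 2 * s"
    unfolding defs by (simp add: power2_norm_eq_inner algebra_simps inner_commute)
  have cs: "s\<^sup>2 \<le> (norm x)\<^sup>2 * (norm y)\<^sup>2"
    unfolding defs by (metis Cauchy_Schwarz_ineq power2_norm_eq_inner)
  have aux: "(1 + X) * (1 + Y) - (1 + s)\<^sup>2 = (X + Y - 2 * s) + (X * Y - s\<^sup>2)" for X Y :: real
    by (simp add: power2_eq_square algebra_simps)
  have diff: "(hx * hy)\<^sup>2 - (1 + s)\<^sup>2 \<ge> (norm (x - y))\<^sup>2"
    unfolding d power_mult_distrib sq aux using cs by linarith
  then have "(1 + s)\<^sup>2 \<le> (hx * hy)\<^sup>2"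
    by (metis diff_ge_0_iff_ge order_trans zero_le_power2)
  then have le: "1 + s \<le> hx * hy"
    by (rule power2_le_imp_le) (use h1 in auto)
  have "(norm (x - y))\<^sup>2 \<le> (hx * hy - (1 + s)) * (hx * hy + (1 + s))"
    using diff by (simp add: power2_eq_square algebra_simps)
  also have "\<dots> \<le> (hx * hy - (1 + s)) * (2 * (hx * hy))"
    using le by (intro mult_left_mono) auto
  finally have 1: "(norm (x - y))\<^sup>2 \<le> 2 * (hx * hy - (1 + s)) * (hx * hy)"
    by (simp add: algebra_simps)
  have mid: "((hx + hy) / 2)\<^sup>2 - hm\<^sup>2 = (hx * hy - (1 + s)) / 2"
    unfolding sqm using sq by (simp add: power2_eq_square field_simps)
  then have "hm\<^sup>2 \<le> ((hx + hy) / 2)\<^sup>2"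
    using le by (simp add: field_simps)
  then have lm: "hm \<le> (hx + hy) / 2"
    by (rule power2_le_imp_le) (use h1 in auto)
  have "(hx * hy - (1 + s)) / 2 = ((hx + hy) / 2 - hm) * ((hx + hy) / 2 + hm)"
    unfolding mid[symmetric] by (simp add: power2_eq_square algebra_simps)
  also have "\<dots> \<le> ((hx + hy) / 2 - hm) * (2 * (1 + A))"
  proof (rule mult_left_mono)
    show "(hx + hy) / 2 + hm \<le> 2 * (1 + A)"
      using lm h1 by argo
    show "0 \<le> (hx + hy) / 2 - hm"
      using lm by simp
  qed
  also have "\<dots> = ((hx + hy) / 2 - hm) * (4 * (1 + A)) / 2"
    by simp
  finally have 2: "hx * hy - (1 + s) \<le> ((hx + hy) / 2 - hm) * (4 * (1 + A))"
    by argo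
  have hh: "hx * hy \<le> (1 + A) * (1 + A)" using h1 by (intro mult_mono) auto
  have "2 * (hx * hy - (1 + s)) * (hx * hy) \<le> 2 * (((hx + hy) / 2 - hm) * (4 * (1 + A))) * ((1 + A) * (1 + A))"
    using 2 hh h1 lm A le by (intro mult_mono) (auto intro!: mult_nonneg_nonneg)
  with 1 show ?thesis
    unfolding defs(1-3)[symmetric] by (simp add: power3_eq_cube algebra_simps add_divide_distrib)
qed

lemma japanese_bracket_midpoint_le:
  fixes x y :: "'a::real_inner"
  shows "japanese_bracket ((x + y) /\<^sub>R 2) \<le> japanese_bracket x / 2 + japanese_bracket y / 2"
proof -
  define A where "A = max (norm x) (norm y)"
  have "0 \<le> 8 * (1 + A) ^ 3 *
    (japanese_bracket x / 2 + japanese_bracket y / 2 - japanese_bracket ((x + y) /\<^sub>R 2))"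
    using japanese_bracket_midpoint_gap[of x A y] by (intro order_trans[OF zero_le_power2]) (auto simp: A_def)
  moreover have "8 * (1 + A) ^ 3 > 0"
    by (auto simp: A_def intro!: zero_less_power add_pos_nonneg max.coboundedI1)
  ultimately show ?thesis
    by (metis diff_ge_0_iff_ge zero_le_mult_iff not_le)
qed

text \<open>Each summand pays for one case. Inside the ball of radius \<open>A\<close> the distance
  is at most \<delta>, or else its square is at least \<delta> times itself and the midpoint gap
  applies. If a point lies outside the ball, the larger norm is controlled by
  superlinearity.\<close>

lemma dist_le_superlinear_midpoint_gap:
  fixes G :: "'a::real_inner \<Rightarrow> real"
  assumes G: "\<And>x. G x \<ge> 0" and A: "\<And>x. norm x > A \<Longrightarrow> norm x \<le> e * G x" and "A \<ge> 0" "\<delta> > 0" "e \<ge> 0"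
  shows "norm (x - y) \<le> \<delta> + 8 * (1 + A) ^ 3 / \<delta> *
      (japanese_bracket x / 2 + japanese_bracket y / 2 - japanese_bracket ((x + y) /\<^sub>R 2)) + 2 * e * (G x + G y)"
    (is "_ \<le> \<delta> + ?c / \<delta> * ?D + _")
proof -
  have D: "?D \<ge> 0"
    using japanese_bracket_midpoint_le[of x y] by simp
  have cD: "?c / \<delta> * ?D \<ge> 0"
    using D assms by (intro mult_nonneg_nonneg) auto
  have eG: "2 * e * (G x + G y) \<ge> 0"
    using G assms by (intro mult_nonneg_nonneg add_nonneg_nonneg) auto
  show ?thesis
  proof (cases "norm x \<le> A \<and> norm y \<le> A")
    case True
    then have gap: "(norm (x - y))\<^sup>2 \<le> ?c * ?D"
      using japanese_bracket_midpoint_gap by blast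
    show ?thesis
    proof (cases "norm (x - y) \<le> \<delta>")
      case False
      then have "\<delta> * norm (x - y) \<le> (norm (x - y))\<^sup>2"
        by (simp add: power2_eq_square mult_right_mono)
      with gap have "norm (x - y) \<le> ?c / \<delta> * ?D"
        using \<open>\<delta> > 0\<close> by (simp add: field_simps)
      with eG \<open>\<delta> > 0\<close> show ?thesis by simp
    qed (use cD eG in auto)
  next
    case False
    have 1: "norm (x - y) \<le> norm x + norm y"
      by (rule norm_triangle_ineq4)
    have "norm x + norm y \<le> 2 * e * (G x + G y)"
    proof (cases "norm x \<le> norm y")
      case True
      then have "norm y \<le> e * G y" using False by (intro A) auto
      moreover have "0 \<le> e * G x" using G assms by auto
      ultimately show ?thesis using True by (simp add: algebra_simps)
    next
      case False': False
      then have "norm x \<le> e * G x" using False False' by (intro A) auto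
      moreover have "0 \<le> e * G y" using G assms by auto
      ultimately show ?thesis using False' by (simp add: algebra_simps)
    qed
    with 1 cD \<open>\<delta> > 0\<close> show ?thesis by linarith
  qed
qed

lemma superlinear_norm_le:
  fixes G :: "'a::real_normed_vector \<Rightarrow> real"
  assumes "\<And>x. G x \<ge> 0" "\<And>e. e > 0 \<Longrightarrow> \<exists>A\<ge>0. \<forall>x. norm x > A \<longrightarrow> norm x \<le> e * G x"
  obtains A where "A \<ge> 0" "\<And>x. norm x \<le> A + G x"
proof -
  obtain A where A: "A \<ge> 0" "\<And>x. norm x > A \<longrightarrow> norm x \<le> G x"
    using assms(2)[of 1] by auto
  then have "norm x \<le> A + G x" for x
    using assms(1)[of x] A(1) A(2)[rule_format, of x] by (cases "norm x > A") linarith+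
  with A show ?thesis using that by blast
qed

lemma (in finite_measure) integrable_superlinear:
  fixes G :: "'b::euclidean_space \<Rightarrow> real"
  assumes "\<And>x. G x \<ge> 0" "\<And>e. e > 0 \<Longrightarrow> \<exists>A\<ge>0. \<forall>x. norm x > A \<longrightarrow> norm x \<le> e * G x"
    and "h \<in> borel_measurable M" "integrable M (\<lambda>t. G (h t))"
  shows "integrable M h"
proof -
  obtain A where "A \<ge> 0" "\<And>x. norm x \<le> A + G x"
    using superlinear_norm_le[of G] assms(1,2) by blast
  with assms(3,4) assms(1) show ?thesis
    by (intro Bochner_Integration.integrable_bound[where f="\<lambda>t. A + G (h t)" and g=h]) auto
qed

text \<open>Riesz-Fischer: some subsequence is Cauchy almost everywhere, and Fatou in the second
  index turns the Cauchy bound into a bound on the distance of the whole sequence to the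
  limit.\<close>

lemma L1_limit:
  fixes s :: "nat \<Rightarrow> 'a \<Rightarrow> 'b::euclidean_space"
  assumes int: "\<And>n. integrable M (s n)"
    and cauchy: "\<And>e. e > 0 \<Longrightarrow> \<exists>N. \<forall>i\<ge>N. \<forall>j\<ge>N. (LINT x|M. norm (s i x - s j x)) < e"
  obtains h r where "strict_mono r" "integrable M h" "AE x in M. (\<lambda>i. s (r i) x) \<longlonglongrightarrow> h x"
    "(\<lambda>n. LINT x|M. norm (s n x - h x)) \<longlonglongrightarrow> 0"
proof -
  obtain r where r: "strict_mono r" "AE x in M. Cauchy (\<lambda>i. s (r i) x)"
    using cauchy_L1_AE_cauchy_subseq[OF int cauchy] by blast
  define h where "h = (\<lambda>x. lim (\<lambda>i. s (r i) x))"
  note int_m[measurable] = borel_measurable_integrable[OF int]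
  have hm[measurable]: "h \<in> borel_measurable M"
    unfolding h_def by measurable
  have conv: "AE x in M. (\<lambda>i. s (r i) x) \<longlonglongrightarrow> h x"
    using r(2) by eventually_elim (auto simp: h_def Cauchy_convergent_iff convergent_LIMSEQ_iff)
  have bound: "integrable M (\<lambda>x. s i x - h x) \<and> (LINT x|M. norm (s i x - h x)) \<le> e"
    if "e > 0" and N: "\<forall>i\<ge>N. \<forall>j\<ge>N. (LINT x|M. norm (s i x - s j x)) < e" "i \<ge> N" for e N i
  proof -
    have "(\<integral>\<^sup>+ x. norm (s i x - h x) \<partial>M) \<le> (\<integral>\<^sup>+ x. liminf (\<lambda>j. ennreal (norm (s i x - s (r j) x))) \<partial>M)"
    proof (rule nn_integral_mono_AE)
      show "AE x in M. ennreal (norm (s i x - h x)) \<le> liminf (\<lambda>j. ennreal (norm (s i x - s (r j) x)))"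
        using conv
      proof eventually_elim
        case (elim x)
        then have "(\<lambda>j. ennreal (norm (s i x - s (r j) x))) \<longlonglongrightarrow> ennreal (norm (s i x - h x))"
          by (intro tendsto_intros)
        from lim_imp_Liminf[OF _ this] show ?case by simp
      qed
    qed
    also have "\<dots> \<le> liminf (\<lambda>j. \<integral>\<^sup>+ x. norm (s i x - s (r j) x) \<partial>M)"
      by (intro nn_integral_liminf) measurable
    also have "\<dots> \<le> ennreal e"
    proof (rule Liminf_le)
      show "\<forall>\<^sub>F j in sequentially. (\<integral>\<^sup>+ x. norm (s i x - s (r j) x) \<partial>M) \<le> ennreal e"
        using eventually_ge_at_top[of N]
      proof eventually_elim
        case (elim j)
        then have "r j \<ge> N" using seq_suble[OF r(1), of j] by linarith
        then have "(LINT x|M. norm (s i x - s (r j) x)) \<le> e" using N by (meson less_imp_le)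
        then show ?case
          using int by (subst nn_integral_eq_integral) (auto intro: ennreal_leI)
      qed
    qed auto
    finally have le: "(\<integral>\<^sup>+ x. norm (s i x - h x) \<partial>M) \<le> ennreal e" .
    then have I: "integrable M (\<lambda>x. s i x - h x)"
      by (intro integrableI_bounded) (auto intro: le_less_trans)
    have "ennreal (LINT x|M. norm (s i x - h x)) \<le> ennreal e"
      using le I by (subst (asm) nn_integral_eq_integral) auto
    then show ?thesis using I \<open>e > 0\<close> by (auto simp: ennreal_le_iff)
  qed
  have "(\<lambda>n. LINT x|M. norm (s n x - h x)) \<longlonglongrightarrow> 0"
  proof (rule LIMSEQ_I)
    fix e :: real assume "e > 0"
    obtain N where N: "\<forall>i\<ge>N. \<forall>j\<ge>N. (LINT x|M. norm (s i x - s j x)) < e/2"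
      using cauchy[of "e/2"] \<open>e > 0\<close> by auto
    then show "\<exists>no. \<forall>n\<ge>no. norm ((LINT x|M. norm (s n x - h x)) - 0) < e"
      using bound[OF _ N] \<open>e > 0\<close> by (intro exI[of _ N]) fastforce
  qed
  moreover have "integrable M h"
  proof -
    obtain N where N: "\<forall>i\<ge>N. \<forall>j\<ge>N. (LINT x|M. norm (s i x - s j x)) < 1"
      using cauchy[of 1] by auto
    have "integrable M (\<lambda>x. s N x - (s N x - h x))"
      by (rule Bochner_Integration.integrable_diff[OF int conjunct1[OF bound[OF zero_less_one N order_refl]]])
    moreover have "(\<lambda>x. s N x - (s N x - h x)) = h"
      by auto
    ultimately show ?thesis by simp
  qed
  ultimately show ?thesis
    using that r(1) conv by blast
qed

text \<open>Near-minimisers of the strictly convex functional \<open>\<integral> sqrt (1 + |h|\<^sup>2)\<close> over a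
  decreasing sequence of convex sets form a Cauchy sequence in \<open>L\<^sup>1\<close>; the superlinear bound
  supplies uniform integrability.  This replaces weak compactness in \<open>L\<^sup>1\<close>.\<close>

lemma (in finite_measure) decseq_convex_L1_limit:
  fixes G :: "'b::euclidean_space \<Rightarrow> real" and S :: "nat \<Rightarrow> ('a \<Rightarrow> 'b) set"
  assumes G: "\<And>x. G x \<ge> 0" and sup: "\<And>e. e > 0 \<Longrightarrow> \<exists>A\<ge>0. \<forall>x. norm x > A \<longrightarrow> norm x \<le> e * G x"
    and ne: "\<And>k. S k \<noteq> {}" and dec: "decseq S"
    and meas: "\<And>k h. h \<in> S k \<Longrightarrow> h \<in> borel_measurable M"
    and int: "\<And>k h. h \<in> S k \<Longrightarrow> integrable M (\<lambda>t. G (h t))"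
    and bound: "\<And>k h. h \<in> S k \<Longrightarrow> (LINT t|M. G (h t)) \<le> c"
    and mid: "\<And>k h h'. h \<in> S k \<Longrightarrow> h' \<in> S k \<Longrightarrow> (\<lambda>t. (h t + h' t) /\<^sub>R 2) \<in> S k"
  obtains s h where "\<And>k. s k \<in> S k" "integrable M h" "AE t in M. (\<lambda>k. s k t) \<longlonglongrightarrow> h t"
    "(\<lambda>k. LINT t|M. norm (s k t - h t)) \<longlonglongrightarrow> 0"
proof -
  define \<phi> where "\<phi> h = (LINT t|M. japanese_bracket (h t))" for h :: "'a \<Rightarrow> 'b"
  have ih: "integrable M h" if "h \<in> S k" for h k
    using integrable_superlinear[OF G sup meas[OF that] int[OF that]] .
  have i\<phi>: "integrable M (\<lambda>t. japanese_bracket (h t))" if "h \<in> S k" for h k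
    using ih[OF that] meas[OF that]
    by (intro Bochner_Integration.integrable_bound[where f="\<lambda>t. 1 + norm (h t)" and g="\<lambda>t. japanese_bracket (h t)"])
       (auto intro: order_trans[OF japanese_bracket_le])
  obtain A1 where A1: "A1 \<ge> 0" "\<And>x. norm x \<le> A1 + G x"
    using superlinear_norm_le[of G] G sup by blast
  have \<phi>0: "\<phi> h \<ge> 0" for h
    unfolding \<phi>_def by (intro integral_nonneg_AE) auto
  define B where "B = (1 + A1) * measure M (space M) + c"
  have \<phi>B: "\<phi> h \<le> B" if "h \<in> S k" for h k
  proof -
    have "\<phi> h \<le> (LINT t|M. (1 + A1) + G (h t))"
      unfolding \<phi>_def
    proof (rule integral_mono)
      show "japanese_bracket (h t) \<le> (1 + A1) + G (h t)" for t
        using japanese_bracket_le[of "h t"] A1(2)[of "h t"] by linarith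
    qed (use i\<phi>[OF that] int[OF that] in auto)
    also have "\<dots> \<le> B"
      using int[OF that] bound[OF that] by (subst Bochner_Integration.integral_add) (auto simp: B_def algebra_simps)
    finally show ?thesis .
  qed
  define a where "a k = Inf (\<phi> ` S k)" for k
  have bdd: "bdd_below (\<phi> ` S k)" for k
    using \<phi>0 by (intro bdd_belowI[of _ 0]) auto
  have a_le: "a k \<le> \<phi> h" if "h \<in> S k" for h k
    unfolding a_def using bdd that by (intro cInf_lower) auto
  \<comment> \<open>Smaller sets have larger infima, and \<open>B\<close> bounds them all, so the
    infima converge. This common limit is what ties together near-minimisers over different
    sets.\<close>
  have "incseq a"
    unfolding a_def using dec ne bdd by (intro incseq_SucI cInf_superset_mono image_mono) (auto simp: decseq_Suc_iff)
  moreover have "a k \<le> B" for k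
    using ne[of k] a_le \<phi>B by (meson ex_in_conv order_trans)
  ultimately obtain l where al: "a \<longlonglongrightarrow> l"
    by (meson incseq_convergent)
  have "\<exists>h\<in>S k. \<phi> h < a k + inverse (Suc k)" for k
    unfolding a_def using cInf_lessD[of "\<phi> ` S k" "Inf (\<phi> ` S k) + inverse (Suc k)"] ne[of k] by auto
  then obtain s where s: "\<And>k. s k \<in> S k" "\<And>k. \<phi> (s k) < a k + inverse (Suc k)"
    by metis
  have \<phi>l: "(\<lambda>k. \<phi> (s k)) \<longlonglongrightarrow> l"
  proof (rule tendsto_sandwich[OF _ _ al])
    show "(\<lambda>k. a k + inverse (Suc k)) \<longlonglongrightarrow> l"
      using tendsto_add[OF al LIMSEQ_inverse_real_of_nat] by simp
    show "\<forall>\<^sub>F k in sequentially. a k \<le> \<phi> (s k)"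
      using s(1) a_le by (intro always_eventually allI) blast
    show "\<forall>\<^sub>F k in sequentially. \<phi> (s k) \<le> a k + inverse (Suc k)"
      using s(2) by (intro always_eventually allI less_imp_le)
  qed
  have sub: "S j \<subseteq> S k" if "k \<le> j" for j k
    using dec that by (auto simp: decseq_def)
  have cauchy: "\<exists>N. \<forall>i\<ge>N. \<forall>j\<ge>N. (LINT t|M. norm (s i t - s j t)) < e" if "e > 0" for e
  proof -
    \<comment> \<open>The budget is \<open>e / 4\<close> for \<delta>, \<open>e / 2\<close> for the
      midpoint gap and less than \<open>e / 4\<close> for the superlinear tail; each
      \<open>+ 1\<close> in a denominator avoids division by zero.\<close>
    define e' where "e' = e / 16 / (\<bar>c\<bar> + 1)"
    have e': "e' > 0" using that by (auto simp: e'_def intro!: divide_pos_pos)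
    obtain A where A: "A \<ge> 0" "\<And>x. norm x > A \<Longrightarrow> norm x \<le> e' * G x"
      using sup[OF e'] by blast
    define \<delta> where "\<delta> = e / 4 / (measure M (space M) + 1)"
    have \<delta>: "\<delta> > 0" using that by (auto simp: \<delta>_def intro!: divide_pos_pos add_nonneg_pos)
    define d where "d = 8 * (1 + A) ^ 3 / \<delta>"
    have d: "d \<ge> 0" using \<delta> A by (auto simp: d_def)
    define \<eta> where "\<eta> = e / (4 * (d + 1))"
    have \<eta>: "\<eta> > 0" using that d by (auto simp: \<eta>_def)
    have "\<forall>\<^sub>F k in sequentially. \<phi> (s k) < l + \<eta> \<and> a k > l - \<eta>"
      using order_tendstoD(2)[OF \<phi>l, of "l + \<eta>"] order_tendstoD(1)[OF al, of "l - \<eta>"] \<eta>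
      by (auto simp: eventually_conj_iff)
    then obtain N where N: "\<And>k. k \<ge> N \<Longrightarrow> \<phi> (s k) < l + \<eta> \<and> a k > l - \<eta>"
      by (auto simp: eventually_sequentially)
    have "(LINT t|M. norm (s i t - s j t)) < e" if ij: "i \<ge> N" "j \<ge> N" for i j
    proof -
      let ?m = "\<lambda>t. (s i t + s j t) /\<^sub>R 2"
      have mem: "s i \<in> S N" "s j \<in> S N" "?m \<in> S N"
        using s sub ij mid[of "s i" N "s j"] by blast+
      let ?D = "\<lambda>t. japanese_bracket (s i t) / 2 + japanese_bracket (s j t) / 2 - japanese_bracket (?m t)"
      have iD: "integrable M ?D"
        using mem by (intro Bochner_Integration.integrable_diff Bochner_Integration.integrable_add
            integrable_divide i\<phi>) auto
      have "(LINT t|M. norm (s i t - s j t)) \<le> (LINT t|M. \<delta> + d * ?D t + 2 * e' * (G (s i t) + G (s j t)))"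
      proof (rule integral_mono)
        show "integrable M (\<lambda>t. norm (s i t - s j t))"
          using ih mem by auto
        show "integrable M (\<lambda>t. \<delta> + d * ?D t + 2 * e' * (G (s i t) + G (s j t)))"
          using iD int mem by auto
        show "norm (s i t - s j t) \<le> \<delta> + d * ?D t + 2 * e' * (G (s i t) + G (s j t))" for t
          unfolding d_def using A \<delta> e' G by (intro dist_le_superlinear_midpoint_gap) auto
      qed
      also have "\<dots> = \<delta> * measure M (space M) + d * (LINT t|M. ?D t)
          + 2 * e' * ((LINT t|M. G (s i t)) + (LINT t|M. G (s j t)))"
        using iD int mem by (subst Bochner_Integration.integral_add) (auto simp: mult.commute)
      also have "(LINT t|M. ?D t) = \<phi> (s i) / 2 + \<phi> (s j) / 2 - \<phi> ?m"
        unfolding \<phi>_def using mem i\<phi>[of "s i" N] i\<phi>[of "s j" N] i\<phi>[of ?m N] by simp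
      \<comment> \<open>The midpoint belongs to \<open>S N\<close>, so \<phi> exceeds
        \<open>l - \<eta>\<close> there, while it stays below \<open>l + \<eta>\<close> at
        \<open>s i\<close> and \<open>s j\<close>. The gap is therefore less than
        \<open>2 * \<eta>\<close>.\<close>
      also have "d * (\<phi> (s i) / 2 + \<phi> (s j) / 2 - \<phi> ?m) \<le> d * (2 * \<eta>)"
        using N[of i] N[of j] N[of N] a_le[OF mem(3)] ij d by (intro mult_left_mono) auto
      also have "d * (2 * \<eta>) \<le> e / 2"
        using d that \<open>e > 0\<close> by (simp add: \<eta>_def field_simps)
      also have "\<delta> * measure M (space M) \<le> e / 4"
      proof -
        have m0: "measure M (space M) + 1 > 0" by (simp add: add_nonneg_pos)
        have "\<delta> * measure M (space M) \<le> \<delta> * (measure M (space M) + 1)"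
          using \<delta> by simp
        also have "\<dots> = e / 4" using m0 unfolding \<delta>_def by (metis less_irrefl nonzero_eq_divide_eq)
        finally show ?thesis .
      qed
      also have "2 * e' * ((LINT t|M. G (s i t)) + (LINT t|M. G (s j t))) \<le> 2 * e' * (2 * \<bar>c\<bar>)"
        using bound[OF mem(1)] bound[OF mem(2)] e' by (intro mult_left_mono) auto
      also have "\<dots> < e / 4"
      proof -
        have "\<bar>c\<bar> + 1 \<noteq> 0" by linarith
        then have "e' * (\<bar>c\<bar> + 1) = e / 16"
          unfolding e'_def by (metis nonzero_eq_divide_eq)
        then have "2 * e' * (2 * \<bar>c\<bar>) + 4 * e' = e / 4"
          by (simp add: algebra_simps)
        with e' show ?thesis by linarith
      qed
      finally show ?thesis by simp
    qed
    then show ?thesis by blast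
  qed
  obtain h r where hr: "strict_mono r" "integrable M h" "AE x in M. (\<lambda>i. s (r i) x) \<longlonglongrightarrow> h x"
    "(\<lambda>n. LINT x|M. norm (s n x - h x)) \<longlonglongrightarrow> 0"
  proof (rule L1_limit[of M s])
    show "integrable M (s n)" for n
      using s(1) by (rule ih)
  qed (use cauchy in auto)
  show ?thesis
  proof (rule that[of "\<lambda>k. s (r k)" h])
    show "s (r k) \<in> S k" for k
      using s(1)[of "r k"] sub[OF seq_suble[OF hr(1), of k]] by blast
    show "(\<lambda>k. LINT t|M. norm (s (r k) t - h t)) \<longlonglongrightarrow> 0"
      using LIMSEQ_subseq_LIMSEQ[OF hr(4,1)] by (simp add: o_def)
  qed (use hr in auto)
qed

section \<open>Differentiable G-functions with the global doubling condition\<close>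

lemma gradient_eqI: "GDERIV f x :> D \<Longrightarrow> gradient f x = D"
proof -
  assume D: "GDERIV f x :> D"
  have "E = D" if "GDERIV f x :> E" for E
  proof -
    have "(\<lambda>h. inner h E) = (\<lambda>h. inner h D)"
      using that D unfolding gderiv_def by (rule has_derivative_unique)
    then have "inner h (E - D) = 0" for h
      by (metis inner_diff_right diff_self)
    then show ?thesis
      by (metis inner_eq_zero_iff right_minus_eq)
  qed
  then show ?thesis
    unfolding gradient_def using D by blast
qed

lemma linear_eq_inner:
  fixes f :: "'a::euclidean_space \<Rightarrow> real"
  assumes "linear f"
  shows "f h = inner h (\<Sum>b\<in>Basis. f b *\<^sub>R b)"
proof -
  have "f h = f (\<Sum>b\<in>Basis. inner h b *\<^sub>R b)"
    by (simp add: euclidean_representation)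
  also have "\<dots> = (\<Sum>b\<in>Basis. inner h b * f b)"
    using assms by (simp add: linear_sum linear_cmul)
  finally show ?thesis
    by (simp add: inner_sum_right mult.commute)
qed

lemma C1_on_UNIV_gradient:
  fixes f :: "'a::euclidean_space \<Rightarrow> real"
  assumes "C1_on UNIV f"
  shows "GDERIV f x :> gradient f x" "continuous_on UNIV (gradient f)" "continuous_on UNIV f"
proof -
  obtain D :: "'a \<Rightarrow> 'a \<Rightarrow>\<^sub>L real" where D: "continuous_on UNIV D" "\<And>x. (f has_derivative D x) (at x)"
    using assms by (auto simp: C1_on_def)
  have *: "GDERIV f x :> (\<Sum>b\<in>Basis. D x b *\<^sub>R b)" for x
    unfolding gderiv_def using D(2)[of x]
    by (subst linear_eq_inner[symmetric]) (auto intro: bounded_linear.linear blinfun.bounded_linear_right)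
  then have eq: "gradient f = (\<lambda>x. \<Sum>b\<in>Basis. D x b *\<^sub>R b)"
    by (auto simp: gradient_eqI)
  show "GDERIV f x :> gradient f x"
    unfolding eq by (rule *)
  show "continuous_on UNIV (gradient f)"
    unfolding eq by (intro continuous_intros D(1))
  show "continuous_on UNIV f"
    using D(2) has_derivative_continuous by (blast intro: continuous_at_imp_continuous_on)
qed

text \<open>The derivative within the strip is restricted to a slice of fixed time. There all
  directions \<open>(0, h)\<close> are available, so the spatial gradient is a genuine derivative
  even at the end points of the time interval.\<close>

lemma C1_on_Times_gradient:
  fixes f :: "real \<Rightarrow> 'a::euclidean_space \<Rightarrow> real"
  assumes "C1_on (I \<times> UNIV) (\<lambda>(t, x). f t x)"
  shows "t \<in> I \<Longrightarrow> GDERIV (f t) x :> gradient (f t) x"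
    "continuous_on (I \<times> UNIV) (\<lambda>(t, x). gradient (f t) x)"
    "continuous_on (I \<times> UNIV) (\<lambda>(t, x). f t x)"
proof -
  obtain D :: "real \<times> 'a \<Rightarrow> (real \<times> 'a) \<Rightarrow>\<^sub>L real" where D: "continuous_on (I \<times> UNIV) D"
    "\<And>t x. t \<in> I \<Longrightarrow> ((\<lambda>(t, x). f t x) has_derivative D (t, x)) (at (t, x) within I \<times> UNIV)"
    using assms by (auto simp: C1_on_def)
  have *: "GDERIV (f t) x :> (\<Sum>b\<in>Basis. D (t, x) (0, b) *\<^sub>R b)" if t: "t \<in> I" for t x
  proof -
    have "((\<lambda>y. (t, y)) has_derivative (\<lambda>h. (0, h))) (at x)"
      by (auto intro!: derivative_eq_intros)
    moreover have "((\<lambda>(t, x). f t x) has_derivative D (t, x)) (at (t, x) within range (\<lambda>y. (t, y)))"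
      using D(2)[OF t] by (rule has_derivative_subset) (use t in auto)
    ultimately have "(f t has_derivative (\<lambda>h. D (t, x) (0, h))) (at x)"
      using has_derivative_in_compose[of "\<lambda>y. (t, y)" "\<lambda>h. (0, h)" x UNIV "\<lambda>(t, x). f t x" "D (t, x)"]
      by simp
    moreover have "linear (\<lambda>h. D (t, x) (0, h))"
      using calculation has_derivative_linear by blast
    ultimately show ?thesis
      unfolding gderiv_def by (subst linear_eq_inner[symmetric])
  qed
  then have eq: "gradient (f t) x = (\<Sum>b\<in>Basis. D (t, x) (0, b) *\<^sub>R b)" if "t \<in> I" for t x
    using that by (auto simp: gradient_eqI)
  show "GDERIV (f t) x :> gradient (f t) x" if "t \<in> I"
    using * that by (simp add: eq)
  have "continuous_on (I \<times> UNIV) (\<lambda>p. \<Sum>b\<in>Basis. D p (0, b) *\<^sub>R b)"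
    by (intro continuous_intros D(1))
  then show "continuous_on (I \<times> UNIV) (\<lambda>(t, x). gradient (f t) x)"
    by (rule continuous_on_eq) (auto simp: eq)
  show "continuous_on (I \<times> UNIV) (\<lambda>(t, x). f t x)"
    unfolding continuous_on_eq_continuous_within using D(2) by (auto intro!: has_derivative_continuous)
qed

lemma GDERIV_line:
  assumes "GDERIV f x :> D"
  shows "((\<lambda>s. f (x + s *\<^sub>R v)) has_real_derivative inner v D) (at 0)"
proof -
  have "((\<lambda>s. f (x + s *\<^sub>R v)) has_derivative (\<lambda>s. inner (s *\<^sub>R v) D)) (at 0)"
    by (rule has_derivative_compose[where g=f and f="\<lambda>s. x + s *\<^sub>R v"])
       (use assms in \<open>auto simp: gderiv_def intro!: derivative_eq_intros\<close>)
  then show ?thesis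
    by (simp add: has_field_derivative_def mult_commute_abs)
qed

text \<open>Convexity bounds the difference quotients towards \<open>y\<close> by
  \<open>f y - f x\<close> for all steps between 0 and 1, and the directional derivative is their
  limit.\<close>

lemma convex_on_gradient_le:
  fixes f :: "'a::euclidean_space \<Rightarrow> real"
  assumes "convex_on UNIV f" "GDERIV f x :> D"
  shows "f x + inner (y - x) D \<le> f y"
proof -
  let ?q = "\<lambda>s. (f (x + s *\<^sub>R (y - x)) - f x) / s"
  have "((\<lambda>s. f (x + s *\<^sub>R (y - x))) has_real_derivative inner (y - x) D) (at 0)"
    using assms(2) by (rule GDERIV_line)
  then have "(?q \<longlongrightarrow> inner (y - x) D) (at_right 0)"
    unfolding DERIV_def by (auto intro: tendsto_mono[OF at_le])
  moreover have "\<forall>\<^sub>F s in at_right 0. ?q s \<le> f y - f x"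
    unfolding eventually_at_right_field
  proof (intro exI[of _ 1] conjI allI impI)
    fix s :: real assume s: "0 < s" "s < 1"
    have "f ((1 - s) *\<^sub>R x + s *\<^sub>R y) \<le> (1 - s) * f x + s * f y"
      using assms(1) s by (intro convex_onD[OF assms(1)]) auto
    moreover have "(1 - s) *\<^sub>R x + s *\<^sub>R y = x + s *\<^sub>R (y - x)"
      by (simp add: algebra_simps)
    ultimately show "?q s \<le> f y - f x"
      using s by (simp add: field_simps)
  qed auto
  ultimately have "inner (y - x) D \<le> f y - f x"
    by (rule tendsto_upperbound) auto
  then show ?thesis by simp
qed

section \<open>Growth of \<open>G\<close> under global doubling\<close>

locale orlicz_setting =
  fixes T :: real and G :: "'a::euclidean_space \<Rightarrow> real"
  assumes T_pos: "T > 0" and G_function: "G_function G" and C1: "C1_on UNIV G"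
    and Delta2: "Delta2_global G"
begin

abbreviation M :: "real measure" where "M \<equiv> lebesgue_on {-T..T}"

sublocale M: finite_measure M
  by (intro finite_measure_lebesgue_on) auto

lemma measure_M [simp]: "measure M {-T..T} = 2 * T"
  using T_pos by (simp add: measure_restrict_space)

lemma G_nonneg [simp]: "G x \<ge> 0" and G_minus [simp]: "G (- x) = G x" and G_0 [simp]: "G 0 = 0"
  and G_convex: "convex_on UNIV G"
  using G_function by (auto simp: G_function_def)

lemma G_superlinear:
  assumes "e > 0"
  shows "\<exists>A\<ge>0. \<forall>x. norm x > A \<longrightarrow> norm x \<le> e * G x"
proof -
  have "filterlim (\<lambda>x. G x / norm x) at_top at_infinity"
    using G_function by (auto simp: G_function_def)
  then have "\<forall>\<^sub>F x in at_infinity. G x / norm x \<ge> 1 / e"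
    by (simp add: filterlim_at_top)
  then obtain B where B: "\<And>x. norm x \<ge> B \<Longrightarrow> G x / norm x \<ge> 1 / e"
    by (auto simp: eventually_at_infinity)
  have "norm x \<le> e * G x" if "norm x > max 0 B" for x
    using B[of x] that assms by (simp add: field_simps)
  then show ?thesis
    by (intro exI[of _ "max 0 B"]) auto
qed

lemma norm_le_G: obtains A where "A \<ge> 0" "\<And>x. norm x \<le> A + G x"
  using superlinear_norm_le[of G] G_superlinear by auto

lemma doubling: obtains k where "k > 2" "\<And>x. G (2 *\<^sub>R x) \<le> k * G x"
  using Delta2 by (auto simp: Delta2_global_def Delta2_from_def)

lemma G_GDERIV: "GDERIV G x :> gradient G x" and gradient_G_cont: "continuous_on UNIV (gradient G)"
  and G_cont: "continuous_on UNIV G"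
  using C1_on_UNIV_gradient[OF C1] by auto

lemma G_meas [measurable (raw)]: "h \<in> borel_measurable N \<Longrightarrow> (\<lambda>t. G (h t)) \<in> borel_measurable N"
  using borel_measurable_continuous_onI[OF G_cont] by (rule measurable_compose[rotated])

lemma gradient_G_meas [measurable (raw)]:
  "h \<in> borel_measurable N \<Longrightarrow> (\<lambda>t. gradient G (h t)) \<in> borel_measurable N"
  using borel_measurable_continuous_onI[OF gradient_G_cont] by (rule measurable_compose[rotated])

lemma G_midpoint: "G ((x + y) /\<^sub>R 2) \<le> (G x + G y) / 2"
proof -
  have "G ((1 - 1/2) *\<^sub>R x + (1/2) *\<^sub>R y) \<le> (1 - 1/2) * G x + 1/2 * G y"
    by (rule convex_onD[OF G_convex]) auto
  moreover have "(1 - 1/2) *\<^sub>R x + (1/2) *\<^sub>R y = (x + y) /\<^sub>R 2"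
    by (simp add: scaleR_add_right)
  ultimately show ?thesis by simp
qed

text \<open>Midpoint convexity at the doubled arguments, followed by doubling. It plays the part of
  a triangle inequality for modulars: sums of functions with finite modular have finite
  modular.\<close>

lemma G_add_le: obtains k where "k > 0" "\<And>x y. G (x + y) \<le> k * (G x + G y)"
proof -
  obtain k where k: "k > 2" "\<And>x. G (2 *\<^sub>R x) \<le> k * G x"
    using doubling by blast
  have "G (x + y) \<le> k * (G x + G y)" for x y
  proof -
    have "G (x + y) \<le> (G (2 *\<^sub>R x) + G (2 *\<^sub>R y)) / 2"
      using G_midpoint[of "2 *\<^sub>R x" "2 *\<^sub>R y"] by (simp flip: scaleR_add_right)
    also have "\<dots> \<le> (k * G x + k * G y) / 2"
      using k by (intro divide_right_mono add_mono) auto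
    also have "\<dots> \<le> k * (G x + G y)"
      using k by (simp add: algebra_simps)
    finally show ?thesis .
  qed
  with k that[of k] show ?thesis by auto
qed

lemma G_gradient_le: "G x + inner (y - x) (gradient G x) \<le> G y"
  by (rule convex_on_gradient_le[OF G_convex G_GDERIV])

lemma G_bounded_on_cball: obtains B where "B \<ge> 0" "\<And>x. norm x \<le> r \<Longrightarrow> G x \<le> B"
proof -
  have "bounded (G ` cball 0 r)"
    using compact_continuous_image[OF continuous_on_subset[OF G_cont] compact_cball]
    by (intro compact_imp_bounded) auto
  then obtain B where B: "\<forall>x\<in>cball 0 r. norm (G x) \<le> B"
    by (auto simp: bounded_iff)
  have "G x \<le> max 0 B" if "norm x \<le> r" for x
    using B that by (auto simp: le_max_iff_disj)
  then show ?thesis using that[of "max 0 B"] by auto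
qed

text \<open>The subgradient inequality is tested with a unit step in the direction of the gradient
  itself. The bound makes the gradient along a velocity of finite modular integrable.\<close>

lemma norm_gradient_le: obtains k d where "k > 0" "d \<ge> 0" "\<And>x. norm (gradient G x) \<le> k * G x + d"
proof -
  obtain k where k: "k > 0" "\<And>x y. G (x + y) \<le> k * (G x + G y)"
    using G_add_le by blast
  obtain B where B: "B \<ge> 0" "\<And>x. norm x \<le> 1 \<Longrightarrow> G x \<le> B"
    using G_bounded_on_cball by blast
  have "norm (gradient G x) \<le> k * G x + k * B" for x
  proof -
    let ?g = "gradient G x"
    have "norm ?g = inner (sgn ?g) ?g"
      by (cases "?g = 0") (auto simp: sgn_div_norm dot_square_norm power2_eq_square field_simps)
    also have "\<dots> \<le> G (x + sgn ?g)"
      using G_gradient_le[of x "x + sgn ?g"] G_nonneg[of x] unfolding add_diff_cancel_left' by linarith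
    also have "\<dots> \<le> k * (G x + G (sgn ?g))"
      by (rule k)
    also have "\<dots> \<le> k * (G x + B)"
      using k B(2)[of "sgn ?g"] by (simp add: norm_sgn)
    finally show ?thesis by (simp add: algebra_simps)
  qed
  then show ?thesis using that[of k "k * B"] k B by auto
qed

text \<open>By doubling, a zero at \<open>x\<close> would spread to all
  \<open>2 ^ n *\<^sub>R x\<close>, against superlinear growth.\<close>

lemma G_pos: assumes "x \<noteq> 0" shows "G x > 0"
proof (rule ccontr)
  assume "\<not> G x > 0"
  then have 0: "G x = 0" using G_nonneg[of x] by linarith
  obtain k where k: "k > 2" "\<And>x. G (2 *\<^sub>R x) \<le> k * G x"
    using doubling by blast
  have z: "G (2 ^ n *\<^sub>R x) = 0" for n :: nat
  proof (induction n)
    case (Suc n)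
    have "G (2 ^ Suc n *\<^sub>R x) \<le> k * G (2 ^ n *\<^sub>R x)"
      using k(2)[of "2 ^ n *\<^sub>R x"] by simp
    also have "\<dots> = 0" using Suc by simp
    finally show ?case by (rule antisym) simp
  qed (use 0 in auto)
  obtain A where A: "A \<ge> 0" "\<And>x. norm x \<le> A + G x"
    using norm_le_G by blast
  obtain n where "A / norm x < 2 ^ n"
    using real_arch_pow[of 2 "A / norm x"] by auto
  then have "A < norm (2 ^ n *\<^sub>R x)"
    using assms by (simp add: field_simps)
  with A(2)[of "2 ^ n *\<^sub>R x"] z show False by simp
qed

text \<open>\<open>INF\<close> and \<open>SUP\<close> of reals carry information only for bounded
  sets. The subgradient inequality towards \<open>2 *\<^sub>R y\<close> together with doubling
  bounds the quotient by \<open>k - 1\<close>, and towards \<open>0\<close> it gives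
  nonnegativity.\<close>

lemma simonenko_bounds:
  assumes "x \<noteq> 0"
  shows "p_index G * G x \<le> inner x (gradient G x)" "inner x (gradient G x) \<le> q_index G * G x"
proof -
  obtain k where k: "k > 2" "\<And>x. G (2 *\<^sub>R x) \<le> k * G x"
    using doubling by blast
  have up: "simonenko_quotient G y \<le> k - 1" if "y \<noteq> 0" for y
  proof -
    have "inner y (gradient G y) \<le> (k - 1) * G y"
      using G_gradient_le[of y "2 *\<^sub>R y"] k(2)[of y] by (simp add: scaleR_2 algebra_simps)
    then show ?thesis using G_pos[OF that] by (simp add: simonenko_quotient_def field_simps)
  qed
  have lo: "simonenko_quotient G y \<ge> 0" if "y \<noteq> 0" for y
  proof -
    have "0 \<le> inner y (gradient G y)"
      using G_gradient_le[of y 0] order_trans[OF G_nonneg[of y]] by simp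
    then show ?thesis by (simp add: simonenko_quotient_def)
  qed
  have "p_index G \<le> simonenko_quotient G x"
    unfolding p_index_def using assms lo by (intro cINF_lower bdd_belowI2[where m=0]) auto
  then show "p_index G * G x \<le> inner x (gradient G x)"
    using G_pos[OF assms] by (simp add: simonenko_quotient_def field_simps)
  have "simonenko_quotient G x \<le> q_index G"
    unfolding q_index_def using assms up by (intro cSUP_upper bdd_aboveI2[where M="k - 1"]) auto
  then show "inner x (gradient G x) \<le> q_index G * G x"
    using G_pos[OF assms] by (simp add: simonenko_quotient_def field_simps)
qed

section \<open>Power growth along rays\<close>

text \<open>Dividing by the power \<open>r\<close> leaves a derivative whose sign compares the
  Simonenko quotient with \<open>r\<close>. Hence the ratio decreases along rays for
  \<open>r = q_index G\<close> and increases for \<open>r = p_index G\<close>.\<close>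

lemma DERIV_G_ray:
  assumes "s > 0"
  shows "((\<lambda>s. G (s *\<^sub>R x) * s powr (- r)) has_real_derivative
     (inner (s *\<^sub>R x) (gradient G (s *\<^sub>R x)) - r * G (s *\<^sub>R x)) * s powr (- r - 1)) (at s)"
proof -
  have "((\<lambda>s. G (s *\<^sub>R x)) has_derivative (\<lambda>h. inner (h *\<^sub>R x) (gradient G (s *\<^sub>R x)))) (at s)"
    by (rule has_derivative_compose[where g=G and f="\<lambda>s. s *\<^sub>R x"])
       (use G_GDERIV in \<open>auto simp: gderiv_def intro!: derivative_eq_intros\<close>)
  then have 1: "((\<lambda>s. G (s *\<^sub>R x)) has_real_derivative inner x (gradient G (s *\<^sub>R x))) (at s)"
    by (simp add: has_field_derivative_def mult_commute_abs)
  have 2: "s powr (- r) = s * s powr (- r - 1)"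
    using assms by (simp add: powr_diff powr_minus field_simps)
  show ?thesis
    by (rule derivative_eq_intros 1 assms refl)+ (use 2 assms in \<open>simp add: algebra_simps\<close>)
qed

lemma G_scale_q: assumes "s \<ge> 1" shows "G (s *\<^sub>R x) \<le> s powr q_index G * G x"
proof (cases "x = 0")
  case False
  let ?q = "q_index G"
  have "G (s *\<^sub>R x) * s powr (- ?q) \<le> G (1 *\<^sub>R x) * 1 powr (- ?q)"
  proof (rule DERIV_nonpos_imp_nonincreasing[OF assms])
    fix u assume "1 \<le> u" "u \<le> s"
    then show "\<exists>y. DERIV (\<lambda>s. G (s *\<^sub>R x) * s powr (- ?q)) u :> y \<and> y \<le> 0"
      using simonenko_bounds(2)[of "u *\<^sub>R x"] False
      by (intro exI[of _ "(inner (u *\<^sub>R x) (gradient G (u *\<^sub>R x)) - ?q * G (u *\<^sub>R x)) * u powr (- ?q - 1)"]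
          conjI DERIV_G_ray mult_nonpos_nonneg) auto
  qed
  then show ?thesis using assms by (simp add: powr_minus field_simps)
qed auto

lemma G_scale_p: assumes "0 < s" "s \<le> 1" shows "G (s *\<^sub>R x) \<le> s powr p_index G * G x"
proof (cases "x = 0")
  case False
  let ?p = "p_index G"
  have "G (s *\<^sub>R x) * s powr (- ?p) \<le> G (1 *\<^sub>R x) * 1 powr (- ?p)"
  proof (rule DERIV_nonneg_imp_nondecreasing[OF assms(2)])
    fix u assume "s \<le> u" "u \<le> 1"
    then have "u > 0" using assms by simp
    then show "\<exists>y. DERIV (\<lambda>s. G (s *\<^sub>R x) * s powr (- ?p)) u :> y \<and> y \<ge> 0"
      using simonenko_bounds(1)[of "u *\<^sub>R x"] False
      by (intro exI[of _ "(inner (u *\<^sub>R x) (gradient G (u *\<^sub>R x)) - ?p * G (u *\<^sub>R x)) * u powr (- ?p - 1)"]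
          conjI DERIV_G_ray mult_nonneg_nonneg) auto
  qed
  then show ?thesis using assms by (simp add: powr_minus field_simps)
qed auto

section \<open>The Fenchel conjugate\<close>

text \<open>Far out, superlinearity with slope \<open>norm y + 1\<close> beats the inner product; in
  the remaining ball Cauchy-Schwarz suffices. Without such a bound the real-valued
  \<open>SUP\<close> in the conjugate would say nothing.\<close>

lemma fenchel_bdd_above: "bdd_above (range (\<lambda>x. inner x y - G x))"
proof -
  have y: "norm y + 1 > 0" by (simp add: add_nonneg_pos)
  obtain A where A: "A \<ge> 0" "\<And>x. norm x > A \<Longrightarrow> norm x \<le> 1 / (norm y + 1) * G x"
    using G_superlinear[of "1 / (norm y + 1)"] y by (meson zero_less_divide_1_iff)
  have "inner x y - G x \<le> A * norm y" for x
  proof (cases "norm x > A")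
    case True
    have "norm x * (norm y + 1) \<le> G x"
      using A(2)[OF True] y by (simp add: pos_le_divide_eq)
    moreover have "inner x y \<le> norm x * norm y" by (rule norm_cauchy_schwarz)
    ultimately have "inner x y - G x \<le> - norm x" by (simp add: algebra_simps)
    also have "\<dots> \<le> A * norm y" using A(1) by (smt (verit) mult_nonneg_nonneg norm_ge_zero)
    finally show ?thesis .
  next
    case False
    have "inner x y \<le> norm x * norm y" by (rule norm_cauchy_schwarz)
    also have "\<dots> \<le> A * norm y" using False by (intro mult_right_mono) auto
    finally show ?thesis using G_nonneg[of x] by linarith
  qed
  then show ?thesis by (intro bdd_aboveI2)
qed

abbreviation Gstar :: "'a \<Rightarrow> real" where "Gstar \<equiv> fenchel_conjugate G"

lemma fenchel_young: "inner x y \<le> G x + Gstar y"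
  unfolding fenchel_conjugate_def using cSUP_upper[OF UNIV_I fenchel_bdd_above[of y], of x] by simp

lemma Gstar_nonneg [simp]: "Gstar y \<ge> 0"
  using fenchel_young[of 0 y] by simp

text \<open>A supremum of affine functions. The aim is continuity, which a real-valued convex
  function on a Euclidean space has, and hence measurability of \<open>Gstar\<close> along a
  measurable function.\<close>

lemma Gstar_convex: "convex_on UNIV Gstar"
proof (rule convex_onI)
  fix t :: real and x y :: 'a assume t: "0 < t" "t < 1"
  show "Gstar ((1 - t) *\<^sub>R x + t *\<^sub>R y) \<le> (1 - t) * Gstar x + t * Gstar y"
    unfolding fenchel_conjugate_def[of G "(1 - t) *\<^sub>R x + t *\<^sub>R y"]
  proof (rule cSUP_least)
    fix z
    have "(1 - t) * inner z x \<le> (1 - t) * (G z + Gstar x)" "t * inner z y \<le> t * (G z + Gstar y)"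
      using t fenchel_young by (auto intro!: mult_left_mono)
    then show "inner z ((1 - t) *\<^sub>R x + t *\<^sub>R y) - G z \<le> (1 - t) * Gstar x + t * Gstar y"
      by (simp add: inner_add_right algebra_simps)
  qed auto
qed auto

lemma Gstar_meas [measurable (raw)]: "h \<in> borel_measurable N \<Longrightarrow> (\<lambda>t. Gstar (h t)) \<in> borel_measurable N"
  using borel_measurable_continuous_onI[OF convex_on_continuous[OF open_UNIV Gstar_convex]]
  by (rule measurable_compose[rotated])

text \<open>Young's inequality tested with the unit vector in the direction of \<open>y\<close>. It
  makes the force \<open>f\<close> integrable.\<close>

lemma norm_le_Gstar: obtains B where "B \<ge> 0" "\<And>y. norm y \<le> Gstar y + B"
proof -
  obtain B where B: "B \<ge> 0" "\<And>x. norm x \<le> 1 \<Longrightarrow> G x \<le> B"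
    using G_bounded_on_cball by blast
  have "norm y \<le> Gstar y + B" for y
  proof -
    have "norm y = inner (sgn y) y"
      by (cases "y = 0") (auto simp: sgn_div_norm dot_square_norm power2_eq_square field_simps)
    also have "\<dots> \<le> G (sgn y) + Gstar y" by (rule fenchel_young)
    also have "G (sgn y) \<le> B" using B by (simp add: norm_sgn)
    finally show ?thesis by simp
  qed
  then show ?thesis using that B by blast
qed

lemma orlicz_space_iff:
  assumes "\<And>x. H x \<ge> 0" "\<And>h. h \<in> borel_measurable M \<Longrightarrow> (\<lambda>t. H (h t)) \<in> borel_measurable M"
  shows "h \<in> orlicz_space T H \<longleftrightarrow> h \<in> borel_measurable M \<and> integrable M (\<lambda>t. H (h t))"
  unfolding orlicz_space_def integrable_iff_bounded using assms by auto

lemma integrable_of_G: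
  assumes "h \<in> borel_measurable M" "integrable M (\<lambda>t. G (h t))"
  shows "integrable M h"
  by (rule M.integrable_superlinear[of G]) (use assms G_superlinear in auto)

end

section \<open>Curves given by their velocity\<close>

lemma continuous_on_imp_integrable_lebesgue_on:
  fixes u :: "real \<Rightarrow> 'a::euclidean_space"
  assumes "continuous_on {a..b} u"
  shows "integrable (lebesgue_on {a..b}) u"
proof -
  have "u absolutely_integrable_on {a..b}"
    using assms by (intro absolutely_integrable_continuous_real)
  then show ?thesis
    by (intro absolutely_integrable_imp_integrable) auto
qed

lemma continuous_on_imp_measurable_lebesgue_on:
  fixes u :: "real \<Rightarrow> 'a::euclidean_space"
  shows "continuous_on {a..b} u \<Longrightarrow> u \<in> borel_measurable (lebesgue_on {a..b})"
  by (intro borel_measurable_integrable continuous_on_imp_integrable_lebesgue_on)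

text \<open>A violation at one time would persist on an interval of positive length. This is how an
  essential supremum becomes a bound at every time, where (A3) is applied.\<close>

lemma AE_le_continuous_imp_le:
  fixes u :: "real \<Rightarrow> real"
  assumes "a < b" "continuous_on {a..b} u" "AE t in lebesgue_on {a..b}. u t \<le> B" "t \<in> {a..b}"
  shows "u t \<le> B"
proof (rule ccontr)
  assume "\<not> u t \<le> B"
  then have "u t - B > 0" by simp
  then obtain d where d: "d > 0" "\<And>s. s \<in> {a..b} \<Longrightarrow> dist s t < d \<Longrightarrow> dist (u s) (u t) < u t - B"
    using assms(2,4) unfolding continuous_on_iff by metis
  \<comment> \<open>Clipping keeps the interval inside \<open>{a..b}\<close> when \<open>t\<close>
    is an end point; since \<open>a < b\<close>, it keeps positive length.\<close>
  define l r where "l = max a (t - d/2)" and "r = min b (t + d/2)"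
  have lr: "l < r" "{l..r} \<subseteq> {a..b}"
    using assms(1,4) d(1) by (auto simp: l_def r_def)
  have gt: "u s > B" if "s \<in> {l..r}" for s
    using d(2)[of s] that lr(2) d(1) by (force simp: l_def r_def dist_real_def)
  have "AE t in lebesgue. t \<in> {a..b} \<longrightarrow> u t \<le> B"
    using assms(3) by (subst (asm) AE_restrict_space_iff) auto
  then have "AE t in lebesgue. t \<notin> {l..r}"
    by eventually_elim (use gt lr(2) in \<open>meson not_le subsetD\<close>)
  then have "{l..r} \<in> null_sets lebesgue"
    by (subst AE_iff_null_sets) auto
  then have "emeasure lebesgue {l..r} = 0"
    by auto
  then show False
    using lr(1) by simp
qed

lemma norm_integral_le:
  fixes g :: "real \<Rightarrow> 'a::euclidean_space"
  assumes "integrable (lebesgue_on {a..b}) g" "a \<le> x" "y \<le> b"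
  shows "norm (integral {x..y} g) \<le> (LINT t|lebesgue_on {a..b}. norm (g t))"
proof -
  have "integrable (lebesgue_on {x..y}) g"
    using assms by (intro integrable_subinterval[OF assms(1)]) auto
  then have "norm (integral {x..y} g) \<le> (LINT t|lebesgue_on {x..y}. norm (g t))"
    by (metis integral_lebesgue_on_atLeastAtMost integral_norm_bound)
  also have "\<dots> \<le> (LINT t|lebesgue_on {a..b}. norm (g t))"
    using assms by (intro integral_mono_lebesgue_on_AE) auto
  finally show ?thesis .
qed

lemma norm_midpoint_le:
  fixes x y :: "'a::real_normed_vector"
  assumes "norm x \<le> e" "norm y \<le> e"
  shows "norm ((x + y) /\<^sub>R 2) \<le> e"
proof -
  have "norm ((x + y) /\<^sub>R 2) = norm (x + y) / 2"
    by simp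
  then show ?thesis
    using norm_triangle_ineq[of x y] assms by linarith
qed

context orlicz_setting
begin

section \<open>Admissible pairs and their sup bound\<close>

definition curve :: "'a \<Rightarrow> (real \<Rightarrow> 'a) \<Rightarrow> real \<Rightarrow> 'a" where
  "curve x g t = x + integral {-T..t} g"

lemma curve_continuous: "integrable M g \<Longrightarrow> continuous_on {-T..T} (curve x g)"
  unfolding curve_def
  by (intro continuous_intros indefinite_integral_continuous_1 integrable_on_lebesgue_on) auto

lemma curve_measurable: "integrable M g \<Longrightarrow> curve x g \<in> borel_measurable M"
  by (intro continuous_on_imp_measurable_lebesgue_on curve_continuous)

lemma integrable_G_continuous:
  "continuous_on {-T..T} u \<Longrightarrow> integrable M (\<lambda>t. G (u t))"
  by (intro continuous_on_imp_integrable_lebesgue_on continuous_on_compose2[OF G_cont]) auto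

lemma vel_curve: "integrable M g \<Longrightarrow> AE t in M. vel (curve x g) t = g t"
  using has_vector_derivative_integral_AE[of "-T" T g x]
  by (auto simp: vel_def curve_def[abs_def] elim!: eventually_mono intro: vector_derivative_at)

lemma vel_curve_measurable: "integrable M g \<Longrightarrow> vel (curve x g) \<in> borel_measurable M"
  by (rule borel_measurable_lebesgue_on_AE_cong[OF borel_measurable_integrable vel_curve])

definition energy :: "'a \<Rightarrow> (real \<Rightarrow> 'a) \<Rightarrow> real" where
  "energy x g = (LINT t|M. G (curve x g t)) + (LINT t|M. G (g t))"

text \<open>The zero mean encodes periodicity, because the increment of the curve over the whole
  interval is the integral of \<open>g\<close>.\<close>

definition admissible :: "'a \<Rightarrow> (real \<Rightarrow> 'a) \<Rightarrow> bool" where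
  "admissible x g \<longleftrightarrow> g \<in> borel_measurable M \<and> integrable M (\<lambda>t. G (g t)) \<and> integral {-T..T} g = 0"

lemma admissibleD:
  assumes "admissible x g"
  shows "integrable M g" "integrable M (\<lambda>t. G (g t))" "g \<in> borel_measurable M" "integral {-T..T} g = 0"
  using assms by (simp_all add: admissible_def integrable_of_G)

lemma admissible_orlicz_sobolev:
  assumes "admissible x g"
  shows "curve x g \<in> orlicz_sobolev T G"
proof -
  have g: "integrable M g" "integrable M (\<lambda>t. G (g t))"
    using admissibleD[OF assms] by simp_all
  have "integrable M (\<lambda>t. G (vel (curve x g) t))"
    using vel_curve[OF g(1), of x] vel_curve_measurable[OF g(1), of x] g
    by (intro integrable_cong_AE_imp[OF g(2)]) (auto elim!: eventually_mono)
  moreover have "curve x g (-T) = curve x g T"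
    using assms by (simp add: curve_def admissible_def)
  moreover have "abs_continuous_on (-T) T (curve x g)"
    unfolding curve_def[abs_def] using g(1) by (rule abs_continuous_on_integral)
  ultimately show ?thesis
    using g by (auto simp: orlicz_sobolev_def orlicz_space_iff vel_curve_measurable curve_measurable
        intro!: integrable_G_continuous curve_continuous)
qed

text \<open>If division by \<open>l\<close> gains a factor \<open>1 / c\<close>, it turns a modular
  of at most \<open>c\<close> into one of at most 1, so \<open>l\<close> is a competitor in the
  infimum that defines the norm.\<close>

lemma luxemburg_norm_le:
  assumes "h \<in> borel_measurable M" "integrable M (\<lambda>t. G (h t))" "(LINT t|M. G (h t)) \<le> c"
    and "c > 0" "l > 0" "\<And>x. G (x /\<^sub>R l) \<le> G x / c"
  shows "luxemburg_norm T G h \<le> l"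
proof -
  have "(\<integral>\<^sup>+ t. ennreal (G (h t /\<^sub>R l)) \<partial>M) \<le> (\<integral>\<^sup>+ t. ennreal (G (h t) / c) \<partial>M)"
    using assms(6) by (intro nn_integral_mono ennreal_leI)
  also have "\<dots> = ennreal (LINT t|M. G (h t) / c)"
    using assms by (intro nn_integral_eq_integral) auto
  also have "\<dots> \<le> ennreal 1"
    using assms by (intro ennreal_leI) simp
  finally have "(\<integral>\<^sup>+ t. ennreal (G (h t /\<^sub>R l)) \<partial>M) \<le> 1"
    by simp
  then show ?thesis
    unfolding luxemburg_norm_def using \<open>l > 0\<close> by (intro cInf_lower bdd_belowI[of _ 0]) auto
qed

text \<open>Both modulars in the energy are nonnegative, so each is at most \<open>c\<close> and
  each norm at most \<open>l\<close>. The factor 2 counts the norms of the curve and of its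
  velocity.\<close>

lemma admissible_sup_bound:
  assumes adm: "admissible x g" and en: "energy x g \<le> c"
    and l: "c > 0" "l > 0" "\<And>x. G (x /\<^sub>R l) \<le> G x / c"
    and C: "embedding_constant T G C" and t: "t \<in> {-T..T}"
  shows "norm (curve x g t) \<le> C * (2 * l)"
proof -
  have g: "integrable M g" "integrable M (\<lambda>t. G (g t))"
    using admissibleD[OF adm] by simp_all
  have cont: "continuous_on {-T..T} (curve x g)" using g(1) by (rule curve_continuous)
  have vg: "integrable M (\<lambda>t. G (vel (curve x g) t))" "(LINT t|M. G (vel (curve x g) t)) = (LINT t|M. G (g t))"
    using vel_curve[OF g(1), of x] vel_curve_measurable[OF g(1), of x] g
    by (intro integrable_cong_AE_imp[OF g(2)] integral_cong_AE; auto elim!: eventually_mono)+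
  have nn: "(LINT t|M. G (curve x g t)) \<ge> 0" "(LINT t|M. G (g t)) \<ge> 0"
    by (auto intro: integral_nonneg_AE)
  have en': "(LINT t|M. G (curve x g t)) \<le> c" "(LINT t|M. G (g t)) \<le> c"
    using en nn unfolding energy_def by linarith+
  have "luxemburg_norm T G (curve x g) \<le> l"
    by (intro luxemburg_norm_le[OF _ _ _ l] integrable_G_continuous cont curve_measurable g en')
  moreover have "luxemburg_norm T G (vel (curve x g)) \<le> l"
    using vg en' by (intro luxemburg_norm_le[OF _ _ _ l] vel_curve_measurable g) simp_all
  ultimately have le: "C * orlicz_sobolev_norm T G (curve x g) \<le> C * (2 * l)"
    using C by (intro mult_left_mono) (auto simp: orlicz_sobolev_norm_def embedding_constant_def)
  have "AE t in M. ereal (norm (curve x g t)) \<le> esssup M (\<lambda>t. ereal (norm (curve x g t)))"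
    by (rule esssup_AE)
  moreover have "esssup M (\<lambda>t. ereal (norm (curve x g t))) \<le> ereal (C * (2 * l))"
    using C admissible_orlicz_sobolev[OF adm] le
    by (auto simp: embedding_constant_def intro: order_trans)
  ultimately have "AE t in M. norm (curve x g t) \<le> C * (2 * l)"
    by (auto elim!: eventually_mono dest: order_trans)
  with t show ?thesis
    using T_pos cont by (intro AE_le_continuous_imp_le[where u="\<lambda>t. norm (curve x g t)"])
      (auto intro: continuous_on_norm)
qed

section \<open>Compactness of sets of bounded energy\<close>

text \<open>De la Vallee-Poussin: superlinear growth bounds the increment by
  \<open>A * (t - s)\<close> plus a small multiple of the modular, uniformly over all velocities of
  modular at most \<open>c\<close>.\<close>

lemma equicontinuous_curves:
  assumes "e > 0"
  obtains d where "d > 0" "\<And>x g s t. admissible x g \<Longrightarrow> (LINT t|M. G (g t)) \<le> c \<Longrightarrow> s \<in> {-T..T} \<Longrightarrow>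
    t \<in> {-T..T} \<Longrightarrow> \<bar>s - t\<bar> < d \<Longrightarrow> norm (curve x g s - curve x g t) < e"
proof -
  \<comment> \<open>Reserves \<open>e / 2\<close> for the modular term, the other half being spent
    on the length; \<open>\<bar>c\<bar> + 1\<close> is positive for every \<open>c\<close>.\<close>
  define e1 where "e1 = e / 2 / (\<bar>c\<bar> + 1)"
  have e1: "e1 > 0" using assms by (auto simp: e1_def)
  obtain A where A: "A \<ge> 0" "\<And>x. norm x > A \<Longrightarrow> norm x \<le> e1 * G x"
    using G_superlinear[OF e1] by blast
  have A': "norm x \<le> A + e1 * G x" for x
  proof (cases "norm x > A")
    case True then show ?thesis using A(2)[of x] A(1) by linarith
  next
    case False
    have "0 \<le> e1 * G x" using e1 by simp
    with False show ?thesis by linarith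
  qed
  have main: "norm (curve x g t - curve x g s) < e"
    if adm: "admissible x g" and c: "(LINT t|M. G (g t)) \<le> c" and st: "s \<in> {-T..T}" "t \<in> {-T..T}" "s \<le> t"
      "t - s < e / 2 / (A + 1)" for x g s t
  proof -
    have g: "integrable M g" "integrable M (\<lambda>t. G (g t))"
      using admissibleD[OF adm] by simp_all
    have g': "integrable (lebesgue_on {s..t}) g" "integrable (lebesgue_on {s..t}) (\<lambda>t. G (g t))"
      using st by (auto intro!: integrable_subinterval[OF g(1)] integrable_subinterval[OF g(2)])
    have "norm (curve x g t - curve x g s) = norm (integral {s..t} g)"
      using integral_from_diff[OF g(1), of s t] st by (simp add: curve_def)
    also have "\<dots> \<le> (LINT t|lebesgue_on {s..t}. norm (g t))"
      using g'(1) by (metis integral_lebesgue_on_atLeastAtMost integral_norm_bound)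
    also have "\<dots> \<le> (LINT t|lebesgue_on {s..t}. A + e1 * G (g t))"
      using g' A' by (intro integral_mono) auto
    also have "\<dots> = A * (t - s) + e1 * (LINT t|lebesgue_on {s..t}. G (g t))"
      using g' st by (subst Bochner_Integration.integral_add) (auto simp: measure_restrict_space)
    also have "(LINT t|lebesgue_on {s..t}. G (g t)) \<le> (LINT t|M. G (g t))"
      using st g by (intro integral_mono_lebesgue_on_AE) auto
    also have "\<dots> \<le> \<bar>c\<bar>" using c by simp
    also have "A * (t - s) \<le> A * (e / 2 / (A + 1))"
      using st A(1) by (intro mult_left_mono) auto
    also have "A * (e / 2 / (A + 1)) < e / 2"
      using A(1) assms by (simp add: divide_less_eq)
    also have "e1 * \<bar>c\<bar> \<le> e / 2"
    proof -
      have "\<bar>c\<bar> + 1 \<noteq> 0" by linarith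
      then have "e1 * (\<bar>c\<bar> + 1) = e / 2"
        unfolding e1_def by (metis nonzero_eq_divide_eq)
      then show ?thesis using e1 by (simp add: algebra_simps)
    qed
    finally show ?thesis using e1 by simp
  qed
  show ?thesis
  proof (rule that[of "e / 2 / (A + 1)"])
    show "e / 2 / (A + 1) > 0" using assms A by auto
    fix x g s t assume H: "admissible x g" "(LINT t|M. G (g t)) \<le> c" "s \<in> {-T..T}"
      "t \<in> {-T..T}" "\<bar>s - t\<bar> < e / 2 / (A + 1)"
    then show "norm (curve x g s - curve x g t) < e"
      using main[OF H(1,2), of s t] main[OF H(1,2), of t s]
      by (cases "s \<le> t") (auto simp: norm_minus_commute)
  qed
qed

lemma G_integral_Fatou:
  assumes s: "\<And>k. s k \<in> borel_measurable M" "\<And>k. integrable M (\<lambda>t. G (s k t))"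
    and h: "h \<in> borel_measurable M" "AE t in M. (\<lambda>k. s k t) \<longlonglongrightarrow> h t"
    and le: "\<And>k. (LINT t|M. G (s k t)) \<le> c k" and c: "c \<longlonglongrightarrow> \<gamma>"
  shows "integrable M (\<lambda>t. G (h t))" "(LINT t|M. G (h t)) \<le> \<gamma>"
proof -
  note [measurable] = s(1) h(1)
  \<comment> \<open>Needed for the passage through \<open>ennreal\<close>, which sends negative
    reals to 0.\<close>
  have \<gamma>: "\<gamma> \<ge> 0"
    by (rule LIMSEQ_le_const[OF c]) (use le in \<open>auto intro!: order_trans[OF integral_nonneg_AE le]\<close>)
  have "(\<integral>\<^sup>+ t. G (h t) \<partial>M) \<le> (\<integral>\<^sup>+ t. liminf (\<lambda>k. ennreal (G (s k t))) \<partial>M)"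
  proof (rule nn_integral_mono_AE)
    show "AE t in M. ennreal (G (h t)) \<le> liminf (\<lambda>k. ennreal (G (s k t)))"
      using h(2)
    proof eventually_elim
      case (elim t)
      have "(\<lambda>k. G (s k t)) \<longlonglongrightarrow> G (h t)"
        by (rule continuous_on_tendsto_compose[OF G_cont elim]) auto
      then have "(\<lambda>k. ennreal (G (s k t))) \<longlonglongrightarrow> ennreal (G (h t))"
        by (intro tendsto_intros)
      from lim_imp_Liminf[OF _ this] show ?case by simp
    qed
  qed
  also have "\<dots> \<le> liminf (\<lambda>k. \<integral>\<^sup>+ t. G (s k t) \<partial>M)"
    by (intro nn_integral_liminf) measurable
  also have "\<dots> \<le> liminf (\<lambda>k. ennreal (c k))"
  proof (intro Liminf_mono always_eventually allI)
    fix k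
    have "(\<integral>\<^sup>+ t. G (s k t) \<partial>M) = ennreal (LINT t|M. G (s k t))"
      using s by (intro nn_integral_eq_integral) auto
    then show "(\<integral>\<^sup>+ t. G (s k t) \<partial>M) \<le> ennreal (c k)"
      using le[of k] by (simp add: ennreal_leI)
  qed
  also have "liminf (\<lambda>k. ennreal (c k)) = ennreal \<gamma>"
    using c by (intro lim_imp_Liminf tendsto_intros) auto
  finally have *: "(\<integral>\<^sup>+ t. G (h t) \<partial>M) \<le> ennreal \<gamma>" .
  then show I: "integrable M (\<lambda>t. G (h t))"
    by (intro integrableI_bounded) (auto intro: le_less_trans)
  have "ennreal (LINT t|M. G (h t)) \<le> ennreal \<gamma>"
    using * I by (subst (asm) nn_integral_eq_integral) auto
  then show "(LINT t|M. G (h t)) \<le> \<gamma>" using \<gamma> by (simp add: ennreal_le_iff)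
qed

text \<open>This stands in for weak lower semicontinuity. The given velocities need not converge,
  but they eventually enter each of a decreasing sequence of midpoint-convex sets, and some other
  selection from these sets converges strongly. Its limit is a velocity of \<open>w\<close> and, by
  Fatou, its modular does not exceed \<gamma>.\<close>

lemma closure_of_velocities:
  assumes adm: "\<And>n. admissible (x n) (g n)"
    and conv: "uniform_limit {-T..T} (\<lambda>n. curve (x n) (g n)) w sequentially"
    and \<gamma>: "(\<lambda>n. LINT t|M. G (g n t)) \<longlonglongrightarrow> \<gamma>"
  obtains h where "admissible (w (-T)) h" "\<And>t. t \<in> {-T..T} \<Longrightarrow> curve (w (-T)) h t = w t"
    "(LINT t|M. G (h t)) \<le> \<gamma>"
proof -
  have g: "integrable M (g n)" "integrable M (\<lambda>t. G (g n t))" "g n \<in> borel_measurable M" for n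
    using admissibleD[OF adm] by simp_all
  \<comment> \<open>Both conditions are convex in \<open>h\<close>, and both relax the desired
    conclusion by \<open>inverse (Suc j)\<close>: modular at most \<gamma>, and primitive equal to
    the increment of \<open>w\<close>.\<close>
  define S where "S j = {h. h \<in> borel_measurable M \<and> integrable M (\<lambda>t. G (h t)) \<and>
    (LINT t|M. G (h t)) \<le> \<gamma> + inverse (Suc j) \<and>
    (\<forall>t\<in>{-T..T}. norm (integral {-T..t} h - (w t - w (-T))) \<le> inverse (Suc j))}" for j
  have inT: "-T \<in> {-T..T}" using T_pos by simp
  have Sint: "h integrable_on {-T..t}" if "h \<in> S j" "t \<in> {-T..T}" for h j t
  proof -
    have "integrable M h" using that by (auto simp: S_def intro: integrable_of_G)
    then have "h integrable_on {-T..T}" by (intro integrable_on_lebesgue_on) auto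
    then show ?thesis using that by (rule_tac integrable_on_subinterval) auto
  qed
  obtain s h where s: "\<And>k. s k \<in> S k" and h: "integrable M h" "AE t in M. (\<lambda>k. s k t) \<longlonglongrightarrow> h t"
    "(\<lambda>k. LINT t|M. norm (s k t - h t)) \<longlonglongrightarrow> 0"
  proof (rule M.decseq_convex_L1_limit[of G S "\<gamma> + 1"])
    fix k
    show "S k \<noteq> {}"
    proof -
      let ?e = "inverse (real (Suc k))"
      have "\<forall>\<^sub>F n in sequentially. (LINT t|M. G (g n t)) < \<gamma> + ?e"
        using order_tendstoD(2)[OF \<gamma>, of "\<gamma> + ?e"] by simp
      moreover have "\<forall>\<^sub>F n in sequentially. \<forall>t\<in>{-T..T}. dist (curve (x n) (g n) t) (w t) < ?e / 2"
        by (rule uniform_limitD[OF conv]) simp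
      ultimately have "\<forall>\<^sub>F n in sequentially. g n \<in> S k"
      proof eventually_elim
        case (elim n)
        have "norm (integral {-T..t} (g n) - (w t - w (-T))) \<le> ?e" if "t \<in> {-T..T}" for t
        proof -
          have "integral {-T..t} (g n) - (w t - w (-T)) = (curve (x n) (g n) t - w t) - (curve (x n) (g n) (-T) - w (-T))"
            by (simp add: curve_def)
          also have "norm \<dots> \<le> norm (curve (x n) (g n) t - w t) + norm (curve (x n) (g n) (-T) - w (-T))"
            by (rule norm_triangle_ineq4)
          also have "\<dots> \<le> ?e / 2 + ?e / 2"
            using elim(2)[rule_format, OF that] elim(2)[rule_format, OF inT]
            unfolding dist_norm by (intro add_mono less_imp_le)
          finally show ?thesis by simp
        qed
        with elim(1) g show ?case by (auto simp: S_def)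
      qed
      then show ?thesis by (auto simp: eventually_sequentially)
    qed
    fix a b assume ab: "a \<in> S k" "b \<in> S k"
    show "a \<in> borel_measurable M" "integrable M (\<lambda>t. G (a t))"
      using ab by (auto simp: S_def)
    have "(LINT t|M. G (a t)) \<le> \<gamma> + inverse (real (Suc k))"
      using ab(1) unfolding S_def by blast
    also have "\<dots> \<le> \<gamma> + 1" by (simp add: field_simps)
    finally show "(LINT t|M. G (a t)) \<le> \<gamma> + 1" .
    show "(\<lambda>t. (a t + b t) /\<^sub>R 2) \<in> S k"
    proof -
      have m: "(\<lambda>t. (a t + b t) /\<^sub>R 2) \<in> borel_measurable M"
        using ab by (auto simp: S_def)
      have bi: "integrable M (\<lambda>t. (G (a t) + G (b t)) / 2)"
        using ab by (auto simp: S_def)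
      have i: "integrable M (\<lambda>t. G ((a t + b t) /\<^sub>R 2))"
        using m G_midpoint by (intro Bochner_Integration.integrable_bound[OF bi]) auto
      have "(LINT t|M. G ((a t + b t) /\<^sub>R 2)) \<le> (LINT t|M. (G (a t) + G (b t)) / 2)"
        by (rule integral_mono[OF i bi G_midpoint])
      also have "\<dots> \<le> \<gamma> + inverse (Suc k)"
        using ab by (auto simp: S_def)
      finally have G: "(LINT t|M. G ((a t + b t) /\<^sub>R 2)) \<le> \<gamma> + inverse (Suc k)" .
      have "norm (integral {-T..t} (\<lambda>t. (a t + b t) /\<^sub>R 2) - (w t - w (-T))) \<le> inverse (Suc k)" (is "norm ?d \<le> ?e")
        if t: "t \<in> {-T..T}" for t
      proof -
        let ?a = "integral {-T..t} a - (w t - w (-T))" and ?b = "integral {-T..t} b - (w t - w (-T))"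
        have "integral {-T..t} (\<lambda>t. (a t + b t) /\<^sub>R 2) = (integral {-T..t} a + integral {-T..t} b) /\<^sub>R 2"
          using Sint[OF _ t] ab by (simp add: Henstock_Kurzweil_Integration.integral_add)
        moreover have "v - z = ((p - z) + (q - z)) /\<^sub>R 2" if "v = (p + q) /\<^sub>R 2" for v p q z :: 'a
        proof -
          have "((p - z) + (q - z)) /\<^sub>R 2 = (p + q) /\<^sub>R 2 - (z + z) /\<^sub>R 2"
            by (simp add: algebra_simps)
          then show ?thesis using that by (simp add: scaleR_half_double)
        qed
        ultimately have d: "?d = (?a + ?b) /\<^sub>R 2" by blast
        have "norm ?a \<le> ?e" "norm ?b \<le> ?e"
          using ab t unfolding S_def by blast+
        then show ?thesis
          unfolding d by (rule norm_midpoint_le)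
      qed
      with m i G show ?thesis by (auto simp: S_def)
    qed
  next
    show "decseq S"
    proof (rule decseq_SucI, rule subsetI)
      fix n v assume v: "v \<in> S (Suc n)"
      have "inverse (real (Suc (Suc n))) \<le> inverse (real (Suc n))"
        by (intro le_imp_inverse_le) auto
      then show "v \<in> S n"
        using v unfolding S_def by (auto intro: order_trans)
    qed
  qed (use G_superlinear in auto)
  have hm: "h \<in> borel_measurable M" using h(1) by auto
  have lim: "(\<lambda>k. \<gamma> + inverse (real (Suc k))) \<longlonglongrightarrow> \<gamma>"
    using tendsto_add[OF tendsto_const LIMSEQ_inverse_real_of_nat, of \<gamma>] by simp
  have hG: "integrable M (\<lambda>t. G (h t))" "(LINT t|M. G (h t)) \<le> \<gamma>"
    using G_integral_Fatou[of s h "\<lambda>k. \<gamma> + inverse (real (Suc k))" \<gamma>] s hm h(2) lim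
    by (auto simp: S_def)
  have hw: "integral {-T..t} h = w t - w (-T)" if t: "t \<in> {-T..T}" for t
  proof (rule LIMSEQ_unique)
    have si: "integrable M (s k)" for k
      using s[of k] by (auto simp: S_def intro: integrable_of_G)
    show "(\<lambda>k. integral {-T..t} (s k)) \<longlonglongrightarrow> integral {-T..t} h"
    proof (rule tendsto_dist_iff[THEN iffD2, OF tendsto_sandwich[OF _ _ tendsto_const h(3)]]; intro always_eventually allI)
      fix k
      have d: "integrable M (\<lambda>t. s k t - h t)" using si h by auto
      have hI: "h integrable_on {-T..t}"
        using integrable_on_lebesgue_on[OF integrable_subinterval[OF h(1), of "-T" t]] t by auto
      have "dist (integral {-T..t} (s k)) (integral {-T..t} h) = norm (integral {-T..t} (\<lambda>t. s k t - h t))"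
        using Sint[OF s t] hI by (simp add: dist_norm Henstock_Kurzweil_Integration.integral_diff)
      also have "\<dots> \<le> (LINT t|M. norm (s k t - h t))"
        using t by (intro norm_integral_le[OF d]) auto
      finally show "dist (integral {-T..t} (s k)) (integral {-T..t} h) \<le> (LINT t|M. norm (s k t - h t))" .
    qed simp
    show "(\<lambda>k. integral {-T..t} (s k)) \<longlonglongrightarrow> w t - w (-T)"
      by (rule tendsto_dist_iff[THEN iffD2, OF tendsto_sandwich[OF _ _ tendsto_const LIMSEQ_inverse_real_of_nat]])
        (use s t in \<open>auto simp: S_def dist_norm\<close>)
  qed
  \<comment> \<open>Periodicity survives pointwise limits; combined with the formula for the
    primitive at time \<open>T\<close> it gives \<open>h\<close> zero mean.\<close>
  have "w T = w (-T)"
  proof (rule LIMSEQ_unique)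
    show "(\<lambda>n. curve (x n) (g n) T) \<longlonglongrightarrow> w T"
      using T_pos by (intro tendsto_uniform_limitI[OF conv]) auto
    have "curve (x n) (g n) T = curve (x n) (g n) (-T)" for n
      using adm[of n] by (simp add: admissible_def curve_def)
    moreover have "(\<lambda>n. curve (x n) (g n) (-T)) \<longlonglongrightarrow> w (-T)"
      using inT by (intro tendsto_uniform_limitI[OF conv]) auto
    ultimately show "(\<lambda>n. curve (x n) (g n) T) \<longlonglongrightarrow> w (-T)"
      by simp
  qed
  with hw[of T] T_pos have "integral {-T..T} h = 0" by simp
  with hm hG(1) have "admissible (w (-T)) h" by (simp add: admissible_def)
  with hG hw show ?thesis
    using that[of h] by (simp add: curve_def)
qed

end

section \<open>Minimisers of the action\<close>

lemma GDERIV_quotient_LIMSEQ: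
  assumes "GDERIV f x :> D" "\<sigma> \<longlonglongrightarrow> 0" "\<And>n. \<sigma> n \<noteq> 0"
  shows "(\<lambda>n. (f (x + \<sigma> n *\<^sub>R v) - f x) / \<sigma> n) \<longlonglongrightarrow> inner v D"
proof -
  have "((\<lambda>s. (f (x + s *\<^sub>R v) - f x) / s) \<longlongrightarrow> inner v D) (at 0)"
    using GDERIV_line[OF assms(1), of v] by (simp add: DERIV_def)
  moreover have "filterlim \<sigma> (at 0) sequentially"
    using assms(2,3) by (auto simp: filterlim_at)
  ultimately show ?thesis
    by (rule filterlim_compose)
qed

lemma GDERIV_isCont: "GDERIV f x :> D \<Longrightarrow> isCont f x"
  unfolding gderiv_def by (rule has_derivative_continuous)

context orlicz_setting
begin

section \<open>Convex variations of admissible pairs\<close>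

lemma integral_uniform_limit:
  assumes "uniform_limit {-T..T} u w sequentially"
    and "\<And>n. continuous_on {-T..T} (u n)" "continuous_on {-T..T} w"
    and "\<And>n t. t \<in> {-T..T} \<Longrightarrow> norm (u n t) \<le> r"
    and "\<And>v. continuous_on {-T..T} v \<Longrightarrow> (\<lambda>t. H t (v t)) \<in> borel_measurable M"
    and "\<And>t x. t \<in> {-T..T} \<Longrightarrow> isCont (H t) x"
    and "integrable M k" "\<And>t x. t \<in> {-T..T} \<Longrightarrow> norm x \<le> r \<Longrightarrow> \<bar>H t x\<bar> \<le> k t"
  shows "(\<lambda>n. LINT t|M. H t (u n t)) \<longlonglongrightarrow> (LINT t|M. H t (w t :: 'a) :: real)"
proof (rule integral_dominated_convergence[where w=k])
  show "AE t in M. (\<lambda>n. H t (u n t)) \<longlonglongrightarrow> H t (w t)"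
  proof (rule AE_I2)
    fix t assume "t \<in> space M"
    then have t: "t \<in> {-T..T}" by simp
    have "(\<lambda>n. u n t) \<longlonglongrightarrow> w t"
      by (rule tendsto_uniform_limitI[OF assms(1) t])
    then show "(\<lambda>n. H t (u n t)) \<longlonglongrightarrow> H t (w t)"
      by (rule isCont_tendsto_compose[OF assms(6)[OF t]])
  qed
qed (use assms in auto)

lemma curve_add_scaleR:
  assumes "integrable M g" "integrable M \<psi>" "t \<in> {-T..T}"
  shows "curve (x + s *\<^sub>R y) (\<lambda>t. g t + s *\<^sub>R \<psi> t) t = curve x g t + s *\<^sub>R curve y \<psi> t"
proof -
  have "g integrable_on {-T..t}" "\<psi> integrable_on {-T..t}"
    using assms integrable_on_lebesgue_on[OF integrable_subinterval[of "-T" T _ "-T" t]] by auto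
  then show ?thesis
    by (simp add: curve_def Henstock_Kurzweil_Integration.integral_add integrable_cmul algebra_simps)
qed

text \<open>Quasi-additivity of \<open>G\<close> reduces the perturbed modular to that of
  \<open>g\<close> and that of a bounded field, and the latter is bounded by a constant.\<close>

lemma admissible_add_scaleR:
  assumes adm: "admissible x g"
    and \<psi>: "\<psi> \<in> borel_measurable M" "\<And>t. norm (\<psi> t) \<le> b" "integral {-T..T} \<psi> = 0"
  shows "admissible (x + s *\<^sub>R y) (\<lambda>t. g t + s *\<^sub>R \<psi> t)"
proof -
  obtain k where k: "k > 0" "\<And>x y. G (x + y) \<le> k * (G x + G y)"
    using G_add_le by blast
  obtain B where B: "B \<ge> 0" "\<And>x. norm x \<le> \<bar>s\<bar> * b \<Longrightarrow> G x \<le> B"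
    using G_bounded_on_cball by blast
  have g: "integrable M g" "integrable M (\<lambda>t. G (g t))" "g \<in> borel_measurable M" "integral {-T..T} g = 0"
    using admissibleD[OF adm] by simp_all
  have i\<psi>: "integrable M \<psi>"
    using \<psi> by (intro M.integrable_const_bound[where B=b]) auto
  have "integrable M (\<lambda>t. G (g t + s *\<^sub>R \<psi> t))"
  proof (rule Bochner_Integration.integrable_bound[where f="\<lambda>t. k * (G (g t) + B)"])
    show "AE t in M. norm (G (g t + s *\<^sub>R \<psi> t)) \<le> norm (k * (G (g t) + B))"
    proof (rule AE_I2)
      fix t
      have "G (g t + s *\<^sub>R \<psi> t) \<le> k * (G (g t) + G (s *\<^sub>R \<psi> t))" by (rule k)
      also have "\<dots> \<le> k * (G (g t) + B)"
        using k by (intro mult_left_mono add_left_mono B(2)) (auto intro!: mult_left_mono \<psi>(2))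
      finally show "norm (G (g t + s *\<^sub>R \<psi> t)) \<le> norm (k * (G (g t) + B))"
        using k B by simp
    qed
  qed (use g \<psi> in auto)
  moreover have "integral {-T..T} (\<lambda>t. g t + s *\<^sub>R \<psi> t) = 0"
    using integrable_on_lebesgue_on[OF g(1)] integrable_on_lebesgue_on[OF i\<psi>] g \<psi>
    by (simp add: Henstock_Kurzweil_Integration.integral_add integrable_cmul)
  ultimately show ?thesis
    using g \<psi> by (auto simp: admissible_def)
qed

lemma G_segment: "0 \<le> s \<Longrightarrow> s \<le> 1 \<Longrightarrow> G (x + s *\<^sub>R y) \<le> (1 - s) * G x + s * G (x + y)"
  using convex_onD[OF G_convex, of s x "x + y"] by (simp add: algebra_simps)

text \<open>Convexity of \<open>G\<close>, applied to curve and velocity separately. For small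
  \<open>s\<close> the right-hand side is close to the energy at \<open>s = 0\<close>, so a strict
  constraint stays satisfied along the segment.\<close>

lemma energy_segment:
  assumes adm: "admissible x g" and s: "0 \<le> s" "s \<le> 1"
    and \<psi>: "\<psi> \<in> borel_measurable M" "\<And>t. norm (\<psi> t) \<le> b" "integral {-T..T} \<psi> = 0"
  shows "energy (x + s *\<^sub>R y) (\<lambda>t. g t + s *\<^sub>R \<psi> t)
    \<le> (1 - s) * energy x g + s * energy (x + y) (\<lambda>t. g t + \<psi> t)"
proof -
  have g: "integrable M g" "integrable M (\<lambda>t. G (g t))"
    using admissibleD[OF adm] by simp_all
  have i\<psi>: "integrable M \<psi>"
    using \<psi> by (intro M.integrable_const_bound[where B=b]) auto
  have i1: "integrable M (\<lambda>t. G (g t + s *\<^sub>R \<psi> t))" and i2: "integrable M (\<lambda>t. G (g t + \<psi> t))"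
    using admissible_add_scaleR[OF adm \<psi>, where s=s] admissible_add_scaleR[OF adm \<psi>, where s=1]
    by (auto simp: admissible_def)
  have c: "continuous_on {-T..T} (curve x g)" "continuous_on {-T..T} (curve y \<psi>)"
    using g i\<psi> by (auto intro: curve_continuous)
  have eq: "(LINT t|M. G (curve (x + r *\<^sub>R y) (\<lambda>t. g t + r *\<^sub>R \<psi> t) t))
      = (LINT t|M. G (curve x g t + r *\<^sub>R curve y \<psi> t))" for r
    using curve_add_scaleR[OF g(1) i\<psi>] by (intro Bochner_Integration.integral_cong) auto
  have j: "integrable M (\<lambda>t. G (curve x g t + r *\<^sub>R curve y \<psi> t))" for r
    by (intro integrable_G_continuous continuous_intros c)
  have "(LINT t|M. G (curve x g t + s *\<^sub>R curve y \<psi> t))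
      \<le> (LINT t|M. (1 - s) * G (curve x g t) + s * G (curve x g t + curve y \<psi> t))"
    using j[of s] j[of 1] integrable_G_continuous[OF c(1)] G_segment[OF s] by (intro integral_mono) auto
  moreover have "(LINT t|M. G (g t + s *\<^sub>R \<psi> t)) \<le> (LINT t|M. (1 - s) * G (g t) + s * G (g t + \<psi> t))"
    using i1 i2 g G_segment[OF s] by (intro integral_mono) auto
  ultimately show ?thesis
    unfolding energy_def eq using eq[of 1] j[of 1] integrable_G_continuous[OF c(1)] i2 g
    by (simp add: algebra_simps)
qed

text \<open>After integration by parts, \<open>v\<close> minus a primitive of \<open>h\<close> is
  tested against bounded zero-mean fields, which determines it up to a constant. An inequality
  suffices, because a suitable test field makes the pairing equal to minus an
  \<open>L\<^sup>1\<close> norm.\<close>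

lemma du_Bois_Reymond:
  fixes v h :: "real \<Rightarrow> 'a"
  assumes v: "integrable M v" and h: "integrable M h"
    and test: "\<And>y \<psi>. \<psi> \<in> borel_measurable M \<Longrightarrow> bounded (range \<psi>) \<Longrightarrow> integral {-T..T} \<psi> = 0 \<Longrightarrow>
      0 \<le> (LINT t|M. inner (\<psi> t) (v t)) + (LINT t|M. inner (curve y \<psi> t) (h t))"
  obtains c where "AE t in M. v t = curve c h t"
proof -
  \<comment> \<open>Constant curves: with zero velocity and starting point
    \<open>- integral {-T..T} h\<close> the hypothesis says that minus a square is
    nonnegative.\<close>
  have h0: "integral {-T..T} h = 0"
  proof -
    have "0 \<le> inner y (integral {-T..T} h)" for y
      using test[of "\<lambda>_. 0" y] h by (simp add: curve_def integral_lebesgue_on_atLeastAtMost)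
    from this[of "- integral {-T..T} h"] have "inner (integral {-T..T} h) (integral {-T..T} h) \<le> 0"
      by simp
    then show ?thesis
      using inner_ge_zero inner_eq_zero_iff order_antisym by blast
  qed
  \<comment> \<open>Integration by parts, carried out as Fubini on the triangle
    \<open>s \<le> t\<close>. The boundary term at \<open>T\<close> vanishes because
    \<open>h\<close> has zero mean.\<close>
  have swap: "(LINT t|M. inner (curve 0 \<psi> t) (h t)) = - (LINT t|M. inner (\<psi> t) (curve 0 h t))"
    if \<psi>[measurable]: "\<psi> \<in> borel_measurable M" and bd: "bounded (range \<psi>)" for \<psi>
  proof -
    note [measurable] = borel_measurable_integrable[OF h]
    obtain b where b: "\<And>t. norm (\<psi> t) \<le> b" using bd by (auto simp: bounded_iff)
    then have b0: "b \<ge> 0" using norm_ge_zero order_trans by blast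
    have i\<psi>: "integrable M \<psi>"
      using \<psi> b by (intro M.integrable_const_bound[where B=b]) auto
    interpret P: pair_sigma_finite M M ..
    have [measurable]: "(\<lambda>x. x) \<in> borel_measurable M"
      using id_borel_measurable_lebesgue_on[of "{-T..T}"] by (simp add: id_def)
    define k where "k t s = (if s \<le> t then inner (\<psi> s) (h t) else 0)" for t s
    have "integrable (M \<Otimes>\<^sub>M M) (\<lambda>(t, s). b * norm (h t))"
      by (rule P.Fubini_integrable) (use h in auto)
    then have "integrable (M \<Otimes>\<^sub>M M) (case_prod k)"
    proof (rule Bochner_Integration.integrable_bound)
      show "case_prod k \<in> borel_measurable (M \<Otimes>\<^sub>M M)"
        unfolding k_def by measurable
      have "norm (k t s) \<le> norm (b * norm (h t))" for t s
        using order_trans[OF Cauchy_Schwarz_ineq2 mult_right_mono[OF b[of s] norm_ge_zero[of "h t"]]] b0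
        by (auto simp: k_def)
      then show "AE p in M \<Otimes>\<^sub>M M. norm (case_prod k p) \<le> norm (case p of (t, s) \<Rightarrow> b * norm (h t))"
        by (auto intro!: AE_I2)
    qed
    then have F: "(LINT s|M. LINT t|M. k t s) = (LINT t|M. LINT s|M. k t s)"
      by (rule P.Fubini_integral)
    have restr: "(LINT s|M. (if s \<in> {p..q} then z s else 0)) = integral {p..q} z"
      if "integrable M z" "-T \<le> p" "q \<le> T" for p q and z :: "real \<Rightarrow> 'a"
    proof -
      have "(LINT s|M. (if s \<in> {p..q} then z s else 0)) = (LINT s|lebesgue_on {p..q}. z s)"
        using that by (intro Lebesgue_Measure.integral_restrict) auto
      also have "\<dots> = integral {p..q} z"
        using that by (intro integral_lebesgue_on_atLeastAtMost integrable_subinterval[OF that(1)]) auto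
      finally show ?thesis .
    qed
    have restr_int: "integrable M (\<lambda>s. if s \<in> {p..q} then z s else 0)"
      if "integrable M z" for p q and z :: "real \<Rightarrow> 'a"
    proof (rule Bochner_Integration.integrable_bound[OF that])
      have [measurable]: "z \<in> borel_measurable M" using that by auto
      show "(\<lambda>s. if s \<in> {p..q} then z s else 0) \<in> borel_measurable M"
        by measurable
    qed auto
    have 1: "(LINT s|M. k t s) = inner (curve 0 \<psi> t) (h t)" if t: "t \<in> {-T..T}" for t
    proof -
      have "(LINT s|M. k t s) = (LINT s|M. inner (if s \<in> {-T..t} then \<psi> s else 0) (h t))"
        by (intro Bochner_Integration.integral_cong) (auto simp: k_def)
      also have "\<dots> = inner (LINT s|M. (if s \<in> {-T..t} then \<psi> s else 0)) (h t)"
        by (intro integral_inner_left restr_int i\<psi>)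
      also have "\<dots> = inner (curve 0 \<psi> t) (h t)"
        using t by (subst restr[OF i\<psi>]) (auto simp: curve_def)
      finally show ?thesis .
    qed
    have 2: "(LINT t|M. k t s) = - inner (\<psi> s) (curve 0 h s)" if s: "s \<in> {-T..T}" for s
    proof -
      have "(LINT t|M. k t s) = (LINT t|M. inner (\<psi> s) (if t \<in> {s..T} then h t else 0))"
        by (intro Bochner_Integration.integral_cong) (auto simp: k_def)
      also have "\<dots> = inner (\<psi> s) (LINT t|M. (if t \<in> {s..T} then h t else 0))"
        by (intro integral_inner_right restr_int h)
      also have "\<dots> = inner (\<psi> s) (integral {s..T} h)"
        using s by (subst restr[OF h]) auto
      also have "integral {s..T} h = - curve 0 h s"
        using integral_from_diff[OF h, of s T] s h0 by (simp add: curve_def)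
      finally show ?thesis by simp
    qed
    have "(LINT t|M. inner (curve 0 \<psi> t) (h t)) = (LINT t|M. LINT s|M. k t s)"
      using 1 by (intro Bochner_Integration.integral_cong) auto
    also have "\<dots> = (LINT s|M. LINT t|M. k t s)" by (rule F[symmetric])
    also have "\<dots> = (LINT s|M. - inner (\<psi> s) (curve 0 h s))"
      using 2 by (intro Bochner_Integration.integral_cong) auto
    finally show ?thesis by simp
  qed
  have cH: "integrable M (curve 0 h)"
    by (intro continuous_on_imp_integrable_lebesgue_on curve_continuous h)
  have ge: "0 \<le> (LINT t|M. inner (\<psi> t) (v t - curve 0 h t))"
    if \<psi>: "\<psi> \<in> borel_measurable M" "bounded (range \<psi>)" "integral {-T..T} \<psi> = 0" for \<psi>
  proof -
    obtain b where b: "\<And>t. norm (\<psi> t) \<le> b" using \<psi>(2) by (auto simp: bounded_iff)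
    have i: "integrable M (\<lambda>t. inner (\<psi> t) (z t))" if "integrable M z" for z
    proof (rule Bochner_Integration.integrable_bound[where f="\<lambda>t. b * norm (z t)"])
      have "norm (inner (\<psi> t) (z t)) \<le> norm (b * norm (z t))" for t
        using order_trans[OF Cauchy_Schwarz_ineq2 mult_right_mono[OF b[of t] norm_ge_zero[of "z t"]]]
        by (auto intro: order_trans)
      then show "AE t in M. norm (inner (\<psi> t) (z t)) \<le> norm (b * norm (z t))" by auto
    qed (use that \<psi> in auto)
    show ?thesis
      using test[OF \<psi>, of 0] swap[OF \<psi>(1,2)] i[OF v] i[OF cH] by (simp add: inner_diff_right)
  qed
  define avg where "avg z = (LINT t|M. z t) /\<^sub>R (2 * T)" for z :: "real \<Rightarrow> 'a"
  have avg: "(LINT t|M. z t - avg z) = 0" if "integrable M z" for z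
    using that T_pos by (simp add: avg_def)
  define w where "w t = v t - curve 0 h t - avg (\<lambda>t. v t - curve 0 h t)" for t
  have w: "integrable M w" "(LINT t|M. w t) = 0"
    unfolding w_def using v cH avg[of "\<lambda>t. v t - curve 0 h t"] by auto
  note [measurable] = borel_measurable_integrable[OF w(1)]
  have sgn_le: "norm (sgn (w t)) \<le> 1" for t
    by (simp add: norm_sgn)
  have i_sgn: "integrable M (\<lambda>t. sgn (w t))"
  proof (rule M.integrable_const_bound[where B=1])
    show "AE t in M. norm (sgn (w t)) \<le> 1" using sgn_le by (intro AE_I2)
    show "(\<lambda>t. sgn (w t)) \<in> borel_measurable M" by (auto simp: sgn_div_norm[abs_def])
  qed
  \<comment> \<open>Steepest descent for the \<open>L\<^sup>1\<close> norm of \<open>w\<close>,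
    shifted to zero mean as the test class demands. The shifts in \<psi> and in \<open>w\<close>
    drop out of the pairing, because each is a constant tested against a field of zero mean.\<close>
  define \<psi> where "\<psi> t = - (sgn (w t) - avg (\<lambda>t. sgn (w t)))" for t
  have i\<psi>: "integrable M \<psi>" "(LINT t|M. \<psi> t) = 0"
    unfolding \<psi>_def using i_sgn avg[OF i_sgn] by auto
  have "norm (\<psi> t) \<le> 1 + norm (avg (\<lambda>t. sgn (w t)))" for t
    unfolding \<psi>_def norm_minus_cancel using sgn_le[of t] norm_triangle_ineq4 by (meson add_right_mono order_trans)
  then have "bounded (range \<psi>)"
    by (auto simp: bounded_iff)
  then have "0 \<le> (LINT t|M. inner (\<psi> t) (v t - curve 0 h t))"
    using i\<psi> by (intro ge) (auto simp: integral_lebesgue_on_atLeastAtMost)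
  also have "(LINT t|M. inner (\<psi> t) (v t - curve 0 h t)) = - (LINT t|M. norm (w t))"
  proof -
    have "inner (\<psi> t) (v t - curve 0 h t)
        = - norm (w t) + inner (avg (\<lambda>t. sgn (w t))) (w t) + inner (\<psi> t) (avg (\<lambda>t. v t - curve 0 h t))" for t
    proof -
      have "inner (sgn (w t)) (w t) = norm (w t)"
        by (cases "w t = 0") (auto simp: sgn_div_norm dot_square_norm power2_eq_square field_simps)
      moreover have "v t - curve 0 h t = w t + avg (\<lambda>t. v t - curve 0 h t)"
        by (simp add: w_def)
      ultimately show ?thesis
        by (simp add: \<psi>_def inner_add_right inner_diff_left algebra_simps)
    qed
    then have "(LINT t|M. inner (\<psi> t) (v t - curve 0 h t)) = (LINT t|M. - norm (w t)
        + inner (avg (\<lambda>t. sgn (w t))) (w t) + inner (\<psi> t) (avg (\<lambda>t. v t - curve 0 h t)))"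
      by presburger
    also have "\<dots> = - (LINT t|M. norm (w t))"
      using w i\<psi> by simp
    finally show ?thesis .
  qed
  finally have "(LINT t|M. norm (w t)) \<le> 0"
    by simp
  moreover have "(LINT t|M. norm (w t)) \<ge> 0"
    by (intro integral_nonneg_AE AE_I2) simp
  ultimately have "(LINT t|M. norm (w t)) = 0"
    by (rule antisym)
  then have "AE t in M. w t = 0"
    using w integral_nonneg_eq_0_iff_AE[where M=M and f="\<lambda>t. norm (w t)"] by auto
  then have "AE t in M. v t = curve (avg (\<lambda>t. v t - curve 0 h t)) h t"
    by eventually_elim (simp add: w_def curve_def algebra_simps)
  then show ?thesis using that by blast
qed

end

section \<open>The direct method for an abstract potential\<close>

text \<open>Caratheodory-type conditions: the force makes the integrand merely measurable in time,
  so measurability is asked along continuous curves. The integrable majorants on balls serve every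
  application of dominated convergence to \<open>F\<close>.\<close>

locale action_setting = orlicz_setting T G for T and G :: "'a::euclidean_space \<Rightarrow> real" +
  fixes F :: "real \<Rightarrow> 'a \<Rightarrow> real" and F' :: "real \<Rightarrow> 'a \<Rightarrow> 'a"
  assumes F_meas: "\<And>u. continuous_on {-T..T} u \<Longrightarrow> (\<lambda>t. F t (u t)) \<in> borel_measurable (lebesgue_on {-T..T})"
    and F'_meas: "\<And>u. continuous_on {-T..T} u \<Longrightarrow> (\<lambda>t. F' t (u t)) \<in> borel_measurable (lebesgue_on {-T..T})"
    and F_GDERIV: "\<And>t x. t \<in> {-T..T} \<Longrightarrow> GDERIV (F t) x :> F' t x"
    and F_bound: "\<And>r. \<exists>k. integrable (lebesgue_on {-T..T}) k \<and>
      (\<forall>t\<in>{-T..T}. \<forall>x. norm x \<le> r \<longrightarrow> \<bar>F t x\<bar> \<le> k t \<and> norm (F' t x) \<le> k t)"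
begin

lemma continuous_curve_bounded:
  assumes "continuous_on {-T..T} u"
  obtains r where "\<And>t. t \<in> {-T..T} \<Longrightarrow> norm (u t :: 'a) \<le> r"
proof -
  have "bounded (u ` {-T..T})"
    by (intro compact_imp_bounded compact_continuous_image assms) auto
  then obtain r where "\<forall>x\<in>u ` {-T..T}. norm x \<le> r"
    unfolding bounded_iff by blast
  then show ?thesis using that[of r] by blast
qed

lemma integrable_F:
  assumes u: "continuous_on {-T..T} u"
  shows "integrable M (\<lambda>t. F t (u t))" "integrable M (\<lambda>t. F' t (u t))"
proof -
  obtain r where r: "\<And>t. t \<in> {-T..T} \<Longrightarrow> norm (u t) \<le> r"
    using continuous_curve_bounded[OF u] by blast
  obtain k where k: "integrable M k"
      "\<And>t x. t \<in> {-T..T} \<Longrightarrow> norm x \<le> r \<Longrightarrow> \<bar>F t x\<bar> \<le> k t \<and> norm (F' t x) \<le> k t"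
    using F_bound[of r] by blast
  show "integrable M (\<lambda>t. F t (u t))" "integrable M (\<lambda>t. F' t (u t))"
    by (rule Bochner_Integration.integrable_bound[OF k(1)];
        use r k F_meas[OF u] F'_meas[OF u] in \<open>force intro!: AE_I2\<close>)+
qed

definition action :: "'a \<Rightarrow> (real \<Rightarrow> 'a) \<Rightarrow> real" where
  "action x g = (LINT t|M. G (g t)) + (LINT t|M. F t (curve x g t))"

text \<open>The radius \<open>r\<close> supplies both a lower bound for the action and a majorant
  for passing to the limit in \<open>F\<close>. The terms depending on the curve converge; the
  velocity enters the constraint and the action through its modular alone, which in the limit is at
  most \<gamma>.\<close>

lemma exists_minimizer:
  assumes c: "c \<ge> 0"
    and r: "\<And>x g t. admissible x g \<Longrightarrow> energy x g \<le> c \<Longrightarrow> t \<in> {-T..T} \<Longrightarrow> norm (curve x g t) \<le> r"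
  obtains x g where "admissible x g" "energy x g \<le> c"
    "\<And>y h. admissible y h \<Longrightarrow> energy y h \<le> c \<Longrightarrow> action x g \<le> action y h"
proof -
  obtain k where k: "integrable M k"
      "\<And>t x. t \<in> {-T..T} \<Longrightarrow> norm x \<le> r \<Longrightarrow> \<bar>F t x\<bar> \<le> k t \<and> norm (F' t x) \<le> k t"
    using F_bound[of r] by blast
  have cont: "continuous_on {-T..T} (curve x g)" if "admissible x g" for x g
    using that by (intro curve_continuous admissibleD)
  have G0: "(LINT t|M. G (u t)) \<ge> 0" for u
    by (rule integral_nonneg_AE) auto
  define A where "A = {(x, g). admissible x g \<and> energy x g \<le> c}"
  have "(0, \<lambda>_. 0) \<in> A"
    using c by (auto simp: A_def admissible_def energy_def curve_def)
  then have Ane: "A \<noteq> {}" by blast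
  define \<A> where "\<A> = (\<lambda>(x, g). action x g)"
  have lower: "- (LINT t|M. k t) \<le> \<A> a" if "a \<in> A" for a
  proof (cases a)
    case (Pair x g)
    then have a: "admissible x g" "energy x g \<le> c" using that by (auto simp: A_def)
    have "(LINT t|M. - k t) \<le> (LINT t|M. F t (curve x g t))"
    proof (rule integral_mono)
      fix t assume "t \<in> space M"
      then show "- k t \<le> F t (curve x g t)"
        using k(2)[of t "curve x g t"] r[OF a] by fastforce
    qed (use k integrable_F(1)[OF cont[OF a(1)]] in auto)
    then have "- (LINT t|M. k t) \<le> action x g"
      using G0[of g] unfolding action_def Bochner_Integration.integral_minus by linarith
    then show ?thesis
      by (simp add: Pair \<A>_def)
  qed
  have bdd: "bdd_below (\<A> ` A)"
    using lower by (rule bdd_belowI2)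
  define l where "l = Inf (\<A> ` A)"
  have "\<exists>a\<in>A. \<A> a < l + inverse (Suc n)" for n
    unfolding l_def using cInf_lessD[of "\<A> ` A" "Inf (\<A> ` A) + inverse (Suc n)"] Ane by auto
  then obtain as where as: "\<And>n. as n \<in> A" "\<And>n. \<A> (as n) < l + inverse (Suc n)"
    by metis
  define X where "X n = fst (as n)" for n
  define g where "g n = snd (as n)" for n
  have asn: "as n = (X n, g n)" for n by (simp add: X_def g_def)
  have adm: "admissible (X n) (g n)" and en: "energy (X n) (g n) \<le> c" for n
    using as(1)[of n] by (auto simp: A_def asn)
  have enG: "(LINT t|M. G (g n t)) \<le> c" for n
    using en[of n] G0[of "curve (X n) (g n)"] unfolding energy_def by linarith
  obtain w \<kappa> where w: "continuous_on {-T..T} w" and \<kappa>: "strict_mono (\<kappa> :: nat \<Rightarrow> nat)"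
    and conv: "\<And>e. 0 < e \<Longrightarrow> \<exists>N. \<forall>n x. n \<ge> N \<and> x \<in> {-T..T} \<longrightarrow> norm (curve (X (\<kappa> n)) (g (\<kappa> n)) x - w x) < e"
  proof (rule Arzela_Ascoli[of "{-T..T}" "\<lambda>n. curve (X n) (g n)" r])
    show "norm (curve (X n) (g n) t) \<le> r" if "t \<in> {-T..T}" for n t
      by (rule r[OF adm en that])
    show "\<exists>d. 0 < d \<and> (\<forall>n y. y \<in> {-T..T} \<and> norm (t - y) < d \<longrightarrow>
        norm (curve (X n) (g n) t - curve (X n) (g n) y) < e)" if "t \<in> {-T..T}" "0 < e" for t e
    proof -
      obtain d where "d > 0" "\<And>x g s t. admissible x g \<Longrightarrow> (LINT t|M. G (g t)) \<le> c \<Longrightarrow> s \<in> {-T..T} \<Longrightarrow>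
          t \<in> {-T..T} \<Longrightarrow> \<bar>s - t\<bar> < d \<Longrightarrow> norm (curve x g s - curve x g t) < e"
        using equicontinuous_curves[OF \<open>0 < e\<close>, of c] by blast
      then show ?thesis
        using adm enG that(1) by (intro exI[of _ d]) auto
    qed
  qed auto
  \<comment> \<open>A second extraction: the velocity modulars must have a true limit along the same
    subsequence, since constraint and action are both compared with it.\<close>
  have "bounded (range (\<lambda>n. LINT t|M. G (g (\<kappa> n) t)))"
    using enG G0 by (auto simp: bounded_iff intro!: exI[of _ c])
  then obtain \<gamma> \<tau> where \<tau>: "strict_mono (\<tau> :: nat \<Rightarrow> nat)"
    and \<gamma>: "((\<lambda>n. LINT t|M. G (g (\<kappa> n) t)) \<circ> \<tau>) \<longlonglongrightarrow> \<gamma>"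
    using bounded_imp_convergent_subsequence by blast
  define q where "q = \<kappa> \<circ> \<tau>"
  have q: "strict_mono q" unfolding q_def using \<kappa> \<tau> by (rule strict_mono_o)
  have ul: "uniform_limit {-T..T} (\<lambda>n. curve (X (q n)) (g (q n))) w sequentially"
    unfolding uniform_limit_sequentially_iff dist_norm
  proof (intro allI impI)
    fix e :: real assume "e > 0"
    then obtain N where N: "\<And>n x. n \<ge> N \<Longrightarrow> x \<in> {-T..T} \<Longrightarrow> norm (curve (X (\<kappa> n)) (g (\<kappa> n)) x - w x) < e"
      using conv by blast
    have "norm (curve (X (q n)) (g (q n)) t - w t) < e" if "t \<in> {-T..T}" "N \<le> n" for t n
      unfolding q_def o_def using seq_suble[OF \<tau>, of n] that by (intro N) auto
    then show "\<exists>N. \<forall>n\<ge>N. \<forall>x\<in>{-T..T}. norm (curve (X (q n)) (g (q n)) x - w x) < e"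
      by blast
  qed
  have \<gamma>': "(\<lambda>n. LINT t|M. G (g (q n) t)) \<longlonglongrightarrow> \<gamma>"
    using \<gamma> by (simp add: q_def o_def)
  obtain h where h: "admissible (w (-T)) h" "\<And>t. t \<in> {-T..T} \<Longrightarrow> curve (w (-T)) h t = w t"
    "(LINT t|M. G (h t)) \<le> \<gamma>"
    using closure_of_velocities[OF adm ul \<gamma>'] by blast
  have cq: "continuous_on {-T..T} (curve (X (q n)) (g (q n)))" for n
    by (rule cont[OF adm])
  have rq: "norm (curve (X (q n)) (g (q n)) t) \<le> r" if "t \<in> {-T..T}" for n t
    by (rule r[OF adm en that])
  obtain B where B: "\<And>x. norm x \<le> r \<Longrightarrow> G x \<le> B"
    using G_bounded_on_cball by blast
  have Gcont: "isCont G x" for x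
    using G_cont by (simp add: continuous_on_eq_continuous_at)
  have limG: "(\<lambda>n. LINT t|M. G (curve (X (q n)) (g (q n)) t)) \<longlonglongrightarrow> (LINT t|M. G (w t))"
    by (rule integral_uniform_limit[OF ul cq w rq, where H="\<lambda>_. G" and k="\<lambda>_. B"])
       (use B Gcont in \<open>auto intro: G_meas continuous_on_imp_measurable_lebesgue_on\<close>)
  have limF: "(\<lambda>n. LINT t|M. F t (curve (X (q n)) (g (q n)) t)) \<longlonglongrightarrow> (LINT t|M. F t (w t))"
    by (rule integral_uniform_limit[OF ul cq w rq, where H=F and k=k])
       (use k F_meas in \<open>auto intro: GDERIV_isCont[OF F_GDERIV]\<close>)
  have wG: "(LINT t|M. G (curve (w (-T)) h t)) = (LINT t|M. G (w t))"
    and wF: "(LINT t|M. F t (curve (w (-T)) h t)) = (LINT t|M. F t (w t))"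
    using h(2) by (auto intro!: Bochner_Integration.integral_cong)
  have "(LINT t|M. G (w t)) + \<gamma> \<le> c"
  proof (rule LIMSEQ_le_const2[OF tendsto_add[OF limG \<gamma>']])
    show "\<exists>N. \<forall>n\<ge>N. (LINT t|M. G (curve (X (q n)) (g (q n)) t)) + (LINT t|M. G (g (q n) t)) \<le> c"
      using en by (auto simp: energy_def)
  qed
  then have e: "energy (w (-T)) h \<le> c"
    using h(3) wG by (simp add: energy_def)
  have "\<gamma> + (LINT t|M. F t (w t)) \<le> l"
  proof (rule LIMSEQ_le[OF tendsto_add[OF \<gamma>' limF]])
    have "(\<lambda>n. l + inverse (real (Suc n))) \<longlonglongrightarrow> l"
      using tendsto_add[OF tendsto_const LIMSEQ_inverse_real_of_nat, of l] by simp
    then show "(\<lambda>n. l + inverse (real (Suc (q n)))) \<longlonglongrightarrow> l"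
      using LIMSEQ_subseq_LIMSEQ[OF _ q] by (force simp: o_def)
    show "\<exists>N. \<forall>n\<ge>N. (LINT t|M. G (g (q n) t)) + (LINT t|M. F t (curve (X (q n)) (g (q n)) t))
        \<le> l + inverse (real (Suc (q n)))"
      using as(2) by (auto simp: \<A>_def asn action_def less_imp_le)
  qed
  then have "action (w (-T)) h \<le> l"
    using h(3) wF by (simp add: action_def)
  moreover have "l \<le> action y z" if "admissible y z" "energy y z \<le> c" for y z
    unfolding l_def using bdd that by (intro cInf_lower) (auto simp: A_def \<A>_def image_iff intro!: bexI[of _ "(y, z)"])
  ultimately show ?thesis
    using that[OF h(1) e] by fastforce
qed

text \<open>The mean value inequality on a ball, which is convex; it majorises the difference
  quotients of \<open>F\<close>.\<close>

lemma F_difference_bound: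
  assumes "t \<in> {-T..T}" "\<And>x. norm x \<le> r \<Longrightarrow> norm (F' t x) \<le> k" "norm x \<le> r" "norm y \<le> r"
  shows "\<bar>F t y - F t x\<bar> \<le> k * norm (y - x)"
proof -
  have "norm (F t y - F t x) \<le> k * norm (y - x)"
  proof (rule differentiable_bound[of "cball 0 r" "F t" "\<lambda>x h. inner h (F' t x)" k])
    fix z :: 'a assume z: "z \<in> cball 0 r"
    show "(F t has_derivative (\<lambda>h. inner h (F' t z))) (at z within cball 0 r)"
      using F_GDERIV[OF assms(1), of z] unfolding gderiv_def by (rule has_derivative_at_withinI)
    show "onorm (\<lambda>h. inner h (F' t z)) \<le> k"
    proof (rule onorm_le)
      fix h
      have "norm (inner h (F' t z)) \<le> norm h * norm (F' t z)" by (simp add: Cauchy_Schwarz_ineq2)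
      also have "\<dots> \<le> norm h * k" using assms(2)[of z] z by (intro mult_left_mono) auto
      finally show "norm (inner h (F' t z)) \<le> k * norm h" by (simp add: mult.commute)
    qed
  qed (use assms in auto)
  then show ?thesis by simp
qed

section \<open>The Euler-Lagrange equation\<close>

text \<open>Difference quotients of the action along steps \<open>1 / (n + 1)\<close> are eventually
  nonnegative, and dominated convergence identifies their limit. One-sided steps are enough because
  the class of variations is symmetric.\<close>

lemma first_variation_nonneg:
  assumes adm: "admissible x g" and en: "energy x g < c"
    and min: "\<And>y h. admissible y h \<Longrightarrow> energy y h \<le> c \<Longrightarrow> action x g \<le> action y h"
    and \<psi>: "\<psi> \<in> borel_measurable M" "\<And>t. norm (\<psi> t) \<le> b" "integral {-T..T} \<psi> = 0"
  shows "0 \<le> (LINT t|M. inner (\<psi> t) (gradient G (g t))) + (LINT t|M. inner (curve y \<psi> t) (F' t (curve x g t)))"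
proof -
  have g: "integrable M g" "integrable M (\<lambda>t. G (g t))" "g \<in> borel_measurable M"
    using admissibleD[OF adm] by simp_all
  note [measurable] = g(3) \<psi>(1)
  have b: "b \<ge> 0" using \<psi>(2)[of 0] norm_ge_zero order_trans by blast
  have i\<psi>: "integrable M \<psi>"
    using \<psi> by (intro M.integrable_const_bound[where B=b]) auto
  have u: "continuous_on {-T..T} (curve x g)" and \<phi>: "continuous_on {-T..T} (curve y \<psi>)"
    using g i\<psi> by (auto intro: curve_continuous)
  obtain r1 where r1: "\<And>t. t \<in> {-T..T} \<Longrightarrow> norm (curve x g t) \<le> r1"
    using continuous_curve_bounded[OF u] by blast
  obtain r2 where r2: "\<And>t. t \<in> {-T..T} \<Longrightarrow> norm (curve y \<psi> t) \<le> r2"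
    using continuous_curve_bounded[OF \<phi>] by blast
  have r20: "r2 \<ge> 0" using r2[of 0] T_pos norm_ge_zero[of "curve y \<psi> 0"] by (meson atLeastAtMost_iff less_imp_le neg_le_0_iff_le order_trans)
  define \<sigma> where "\<sigma> n = inverse (real (Suc n))" for n
  have \<sigma>: "\<sigma> \<longlonglongrightarrow> 0" "\<And>n. 0 < \<sigma> n" "\<And>n. \<sigma> n \<le> 1" "\<And>n. \<sigma> n \<noteq> 0"
    unfolding \<sigma>_def using LIMSEQ_inverse_real_of_nat by (auto simp: field_simps)
  define E1 where "E1 = energy (x + y) (\<lambda>t. g t + \<psi> t)"
  define x' where "x' n = x + \<sigma> n *\<^sub>R y" for n
  define g' where "g' n t = g t + \<sigma> n *\<^sub>R \<psi> t" for n t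
  have adm': "admissible (x' n) (g' n)" for n
    unfolding x'_def g'_def using admissible_add_scaleR[OF adm \<psi>] .
  have cu: "curve (x' n) (g' n) t = curve x g t + \<sigma> n *\<^sub>R curve y \<psi> t" if "t \<in> {-T..T}" for n t
    unfolding x'_def g'_def by (rule curve_add_scaleR[OF g(1) i\<psi> that])
  \<comment> \<open>This expression bounds the perturbed energy by \<open>energy_segment\<close> and
    tends to \<open>energy x g\<close>, which is where the strict inequality in the constraint
    enters.\<close>
  have "\<forall>\<^sub>F n in sequentially. (1 - \<sigma> n) * energy x g + \<sigma> n * E1 < c"
  proof (rule order_tendstoD(2)[OF _ en])
    have "(\<lambda>n. (1 - \<sigma> n) * energy x g + \<sigma> n * E1) \<longlonglongrightarrow> (1 - 0) * energy x g + 0 * E1"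
      by (intro tendsto_intros \<sigma>)
    then show "(\<lambda>n. (1 - \<sigma> n) * energy x g + \<sigma> n * E1) \<longlonglongrightarrow> energy x g" by simp
  qed
  then have ev: "\<forall>\<^sub>F n in sequentially. action x g \<le> action (x' n) (g' n)"
  proof eventually_elim
    case (elim n)
    have "energy (x' n) (g' n) \<le> (1 - \<sigma> n) * energy x g + \<sigma> n * E1"
      unfolding x'_def g'_def E1_def
      using \<sigma>(2,3)[of n] by (intro energy_segment[OF adm _ _ \<psi>]) auto
    with elim show ?case by (intro min adm') auto
  qed
  define q1 where "q1 n t = (G (g t + \<sigma> n *\<^sub>R \<psi> t) - G (g t)) / \<sigma> n" for n t
  define q2 where "q2 n t = (F t (curve x g t + \<sigma> n *\<^sub>R curve y \<psi> t) - F t (curve x g t)) / \<sigma> n" for n t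
  have i1: "integrable M (\<lambda>t. G (g t + \<sigma> n *\<^sub>R \<psi> t))" for n
    using adm'[of n] by (simp add: admissible_def g'_def)
  have i2: "integrable M (\<lambda>t. F t (curve x g t + \<sigma> n *\<^sub>R curve y \<psi> t))" for n
    by (intro integrable_F continuous_intros u \<phi>)
  have Q: "(LINT t|M. q1 n t) + (LINT t|M. q2 n t) = (action (x' n) (g' n) - action x g) / \<sigma> n" for n
  proof -
    have "(LINT t|M. F t (curve (x' n) (g' n) t)) = (LINT t|M. F t (curve x g t + \<sigma> n *\<^sub>R curve y \<psi> t))"
      using cu by (intro Bochner_Integration.integral_cong) auto
    then show ?thesis
      unfolding q1_def q2_def action_def using i1[of n] i2[of n] g(2) integrable_F(1)[OF u]
      by (simp add: g'_def diff_divide_distrib add_divide_distrib)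
  qed
  obtain kg d where kg: "kg > 0" "d \<ge> 0" "\<And>x. norm (gradient G x) \<le> kg * G x + d"
    using norm_gradient_le by blast
  have i1': "integrable M (\<lambda>t. G (g t + \<psi> t))"
    using admissible_add_scaleR[OF adm \<psi>, where s=1] by (simp add: admissible_def)
  \<comment> \<open>Convexity traps the quotient for all steps at once: the subgradient at
    \<open>g t\<close> bounds it from below, the secant up to step 1 from above. The majorant is the
    sum of the two bounds.\<close>
  have lim1: "(\<lambda>n. LINT t|M. q1 n t) \<longlonglongrightarrow> (LINT t|M. inner (\<psi> t) (gradient G (g t)))"
  proof (rule integral_dominated_convergence[where w="\<lambda>t. b * (kg * G (g t) + d) + G (g t + \<psi> t)"])
    show "AE t in M. (\<lambda>n. q1 n t) \<longlonglongrightarrow> inner (\<psi> t) (gradient G (g t))"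
      unfolding q1_def by (intro AE_I2 GDERIV_quotient_LIMSEQ G_GDERIV \<sigma>)
    fix n
    show "AE t in M. norm (q1 n t) \<le> b * (kg * G (g t) + d) + G (g t + \<psi> t)"
    proof (rule AE_I2)
      fix t
      have "- q1 n t \<le> - inner (\<psi> t) (gradient G (g t))"
        using G_gradient_le[of "g t" "g t + \<sigma> n *\<^sub>R \<psi> t"] \<sigma>(2)[of n]
        by (simp add: q1_def field_simps)
      also have "\<dots> \<le> norm (\<psi> t) * norm (gradient G (g t))"
        using Cauchy_Schwarz_ineq2[of "\<psi> t" "gradient G (g t)"] by linarith
      also have "\<dots> \<le> b * (kg * G (g t) + d)"
        using b kg \<psi>(2) by (intro mult_mono) auto
      finally have lo: "- q1 n t \<le> b * (kg * G (g t) + d)" .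
      have "q1 n t \<le> G (g t + \<psi> t) - G (g t)"
        using G_segment[of "\<sigma> n" "g t" "\<psi> t"] \<sigma>(2,3)[of n] by (simp add: q1_def field_simps)
      moreover have "0 \<le> b * (kg * G (g t) + d)"
        using b kg by auto
      ultimately show "norm (q1 n t) \<le> b * (kg * G (g t) + d) + G (g t + \<psi> t)"
        using lo G_nonneg[of "g t"] G_nonneg[of "g t + \<psi> t"] unfolding real_norm_def by linarith
    qed
    show "q1 n \<in> borel_measurable M" unfolding q1_def by measurable
  qed (use g i1' in auto)
  obtain k where k: "integrable M k"
      "\<And>t x. t \<in> {-T..T} \<Longrightarrow> norm x \<le> r1 + r2 \<Longrightarrow> \<bar>F t x\<bar> \<le> k t \<and> norm (F' t x) \<le> k t"
    using F_bound[of "r1 + r2"] by blast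
  have lim2: "(\<lambda>n. LINT t|M. q2 n t) \<longlonglongrightarrow> (LINT t|M. inner (curve y \<psi> t) (F' t (curve x g t)))"
  proof (rule integral_dominated_convergence[where w="\<lambda>t. k t * r2"])
    show "AE t in M. (\<lambda>n. q2 n t) \<longlonglongrightarrow> inner (curve y \<psi> t) (F' t (curve x g t))"
      unfolding q2_def by (intro AE_I2 GDERIV_quotient_LIMSEQ F_GDERIV \<sigma>) auto
    fix n
    show "AE t in M. norm (q2 n t) \<le> k t * r2"
    proof (rule AE_I2)
      fix t assume "t \<in> space M"
      then have t: "t \<in> {-T..T}" by simp
      have "r1 + r2 \<ge> 0"
        using order_trans[OF norm_ge_zero r1[OF t]] r20 by simp
      \<comment> \<open>The origin lies in the ball of radius \<open>r1 + r2\<close>, so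
        \<open>k t\<close> dominates an absolute value.\<close>
      then have k0: "k t \<ge> 0"
        using k(2)[OF t, of 0] abs_ge_zero[of "F t 0"] unfolding norm_zero by (meson order_trans)
      have s: "norm (\<sigma> n *\<^sub>R curve y \<psi> t) \<le> \<sigma> n * r2"
        using r2[OF t] \<sigma>(2)[of n] by simp
      also have "\<dots> \<le> r2" using \<sigma>(2,3)[of n] r20 by (simp add: mult_left_le_one_le)
      finally have s': "norm (\<sigma> n *\<^sub>R curve y \<psi> t) \<le> r2" .
      have "\<bar>F t (curve x g t + \<sigma> n *\<^sub>R curve y \<psi> t) - F t (curve x g t)\<bar>
          \<le> k t * norm (curve x g t + \<sigma> n *\<^sub>R curve y \<psi> t - curve x g t)"
        using k(2)[OF t] r1[OF t] r20 order_trans[OF norm_triangle_ineq add_mono[OF r1[OF t] s']]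
        by (intro F_difference_bound[OF t, where r="r1 + r2"]) auto
      also have "\<dots> \<le> k t * (\<sigma> n * r2)"
        using k0 s by (simp add: mult_left_mono)
      finally show "norm (q2 n t) \<le> k t * r2"
        using \<sigma>(2)[of n] by (simp add: q2_def field_simps)
    qed
    show "q2 n \<in> borel_measurable M"
      unfolding q2_def using i2 integrable_F(1)[OF u] by (intro borel_measurable_divide borel_measurable_diff) auto
    show "(\<lambda>t. inner (curve y \<psi> t) (F' t (curve x g t))) \<in> borel_measurable M"
      by (intro borel_measurable_inner F'_meas u curve_measurable i\<psi>)
  qed (use k in auto)
  show ?thesis
  proof (rule tendsto_lowerbound[OF tendsto_add[OF lim1 lim2]])
    show "\<forall>\<^sub>F n in sequentially. 0 \<le> (LINT t|M. q1 n t) + (LINT t|M. q2 n t)"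
      using ev by eventually_elim (use \<sigma>(2) in \<open>simp add: Q less_imp_le\<close>)
  qed auto
qed

text \<open>The du Bois-Reymond lemma presents the gradient along the velocity as a primitive almost
  everywhere, which is precisely the absolutely continuous representative that
  \<open>ae_time_derivative\<close> asks for.\<close>

lemma minimizer_solves:
  assumes adm: "admissible x g" and en: "energy x g < c"
    and min: "\<And>y h. admissible y h \<Longrightarrow> energy y h \<le> c \<Longrightarrow> action x g \<le> action y h"
  shows "ae_time_derivative T (\<lambda>t. gradient G (vel (curve x g) t)) (\<lambda>t. F' t (curve x g t))"
proof -
  have g: "integrable M g" "integrable M (\<lambda>t. G (g t))" "g \<in> borel_measurable M"
    using admissibleD[OF adm] by simp_all
  have u: "continuous_on {-T..T} (curve x g)"
    using g by (intro curve_continuous)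
  obtain kg d where kg: "kg > 0" "d \<ge> 0" "\<And>x. norm (gradient G x) \<le> kg * G x + d"
    using norm_gradient_le by blast
  have "integrable M (\<lambda>t. gradient G (g t))"
    by (rule Bochner_Integration.integrable_bound[where f="\<lambda>t. kg * G (g t) + d"])
       (use g kg in \<open>auto intro!: AE_I2 intro: order_trans[OF kg(3) abs_ge_self]\<close>)
  moreover have h: "integrable M (\<lambda>t. F' t (curve x g t))"
    by (rule integrable_F(2)[OF u])
  ultimately obtain k where k: "AE t in M. gradient G (g t) = curve k (\<lambda>t. F' t (curve x g t)) t"
  proof (rule du_Bois_Reymond)
    fix y and \<psi> :: "real \<Rightarrow> 'a"
    assume \<psi>: "\<psi> \<in> borel_measurable M" "bounded (range \<psi>)" "integral {-T..T} \<psi> = 0"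
    then obtain b where "\<And>t. norm (\<psi> t) \<le> b" by (auto simp: bounded_iff)
    then show "0 \<le> (LINT t|M. inner (\<psi> t) (gradient G (g t))) + (LINT t|M. inner (curve y \<psi> t) (F' t (curve x g t)))"
      using first_variation_nonneg[OF adm en min] \<psi> by blast
  qed
  have "AE t in M. gradient G (vel (curve x g) t) = curve k (\<lambda>t. F' t (curve x g t)) t"
    using k vel_curve[OF g(1), of x] by eventually_elim simp
  moreover have "abs_continuous_on (-T) T (curve k (\<lambda>t. F' t (curve x g t)))"
    unfolding curve_def[of k, abs_def] using h by (rule abs_continuous_on_integral)
  moreover have "AE t in M. (curve k (\<lambda>t. F' t (curve x g t)) has_vector_derivative F' t (curve x g t)) (at t)"
    unfolding curve_def[of k, abs_def] using h by (rule has_vector_derivative_integral_AE)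
  ultimately show ?thesis
    unfolding ae_time_derivative_def by blast
qed

end

section \<open>The forced system\<close>

text \<open>Both functions admit the same derivatives at each point, so the two definite
  descriptions coincide, differentiable or not.\<close>

lemma gradient_add_const: "gradient (\<lambda>v. f v + c) = gradient f"
proof -
  have "GDERIV (\<lambda>v. f v + c) x :> D \<longleftrightarrow> GDERIV f x :> D" for x D
    using GDERIV_add[OF _ GDERIV_const, of f x D c] GDERIV_add[OF _ GDERIV_const, of "\<lambda>v. f v + c" x D "- c"]
    by auto
  then show ?thesis by (auto simp: gradient_def)
qed

lemma GDERIV_inner_right: "GDERIV (\<lambda>x. inner a x) x :> a"
  unfolding gderiv_def by (auto intro!: derivative_eq_intros simp: inner_commute)

lemma ae_time_derivative_cong:
  assumes "\<And>t. t \<in> {-T..T} \<Longrightarrow> A t = A' t" "\<And>t. t \<in> {-T..T} \<Longrightarrow> B t = B' t"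
    "ae_time_derivative T A B"
  shows "ae_time_derivative T A' B'"
proof -
  obtain w where w: "abs_continuous_on (-T) T w" "AE t in lebesgue_on {-T..T}. A t = w t"
      "AE t in lebesgue_on {-T..T}. (w has_vector_derivative B t) (at t)"
    using assms(3) by (auto simp: ae_time_derivative_def)
  have I: "AE t in lebesgue_on {-T..T}. t \<in> {-T..T}"
    by (rule AE_I2) simp
  have "AE t in lebesgue_on {-T..T}. A' t = w t"
    using I w(2) by eventually_elim (simp add: assms(1))
  moreover have "AE t in lebesgue_on {-T..T}. (w has_vector_derivative B' t) (at t)"
    using I w(3) by eventually_elim (simp add: assms(2))
  ultimately show ?thesis
    using w(1) by (auto simp: ae_time_derivative_def)
qed

text \<open>\<open>V\<close> and its spatial gradient are jointly continuous, hence bounded on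
  compact cylinders; the force is only integrable and contributes its norm to the majorant.\<close>

lemma (in orlicz_setting) action_setting_potential:
  assumes A2: "\<And>t x. t \<in> {-T..T} \<Longrightarrow> V t x = K t x - W t x"
      "C1_on ({-T..T} \<times> UNIV) (\<lambda>(t, x). K t x)" "C1_on ({-T..T} \<times> UNIV) (\<lambda>(t, x). W t x)"
    and f: "f \<in> orlicz_space T Gstar"
  shows "action_setting T G (\<lambda>t x. V t x + inner (f t) x) (\<lambda>t x. gradient (V t) x + f t)"
proof -
  let ?I = "{-T..T} \<times> (UNIV :: 'a set)"
  note K = C1_on_Times_gradient[OF A2(2)] and W = C1_on_Times_gradient[OF A2(3)]
  have Vt: "V t = (\<lambda>x. K t x - W t x)" if "t \<in> {-T..T}" for t
    using A2(1)[OF that] by auto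
  have dV: "GDERIV (V t) x :> gradient (K t) x - gradient (W t) x" if "t \<in> {-T..T}" for t x
    unfolding Vt[OF that] by (intro GDERIV_diff K W that)
  then have gV: "gradient (V t) x = gradient (K t) x - gradient (W t) x" if "t \<in> {-T..T}" for t x
    using that by (intro gradient_eqI)
  have cV: "continuous_on ?I (\<lambda>p. V (fst p) (snd p))"
    using continuous_on_diff[OF K(3) W(3)] by (rule continuous_on_eq) (auto simp: Vt)
  have cgV: "continuous_on ?I (\<lambda>p. gradient (V (fst p)) (snd p))"
    using continuous_on_diff[OF K(2) W(2)] by (rule continuous_on_eq) (auto simp: gV)
  have f': "f \<in> borel_measurable M" "integrable M (\<lambda>t. Gstar (f t))"
    using f by (auto simp: orlicz_space_iff)
  obtain B where B: "B \<ge> 0" "\<And>y. norm y \<le> Gstar y + B"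
    using norm_le_Gstar by blast
  have fi: "integrable M f"
    by (rule Bochner_Integration.integrable_bound[where f="\<lambda>t. Gstar (f t) + B"])
       (use f' B in \<open>auto intro!: AE_I2 intro: order_trans[OF B(2) abs_ge_self]\<close>)
  show ?thesis
  proof unfold_locales
    fix u :: "real \<Rightarrow> 'a" assume u: "continuous_on {-T..T} u"
    have tu: "continuous_on {-T..T} (\<lambda>t. (t, u t))" "(\<lambda>t. (t, u t)) ` {-T..T} \<subseteq> ?I"
      by (auto intro!: continuous_intros u)
    have "(\<lambda>t. V t (u t)) \<in> borel_measurable M" "(\<lambda>t. gradient (V t) (u t)) \<in> borel_measurable M"
      using continuous_on_compose2[OF cV tu] continuous_on_compose2[OF cgV tu]
      by (auto intro!: continuous_on_imp_measurable_lebesgue_on)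
    then show "(\<lambda>t. V t (u t) + inner (f t) (u t)) \<in> borel_measurable M"
      "(\<lambda>t. gradient (V t) (u t) + f t) \<in> borel_measurable M"
      using f'(1) continuous_on_imp_measurable_lebesgue_on[OF u] by auto
  next
    fix t x assume t: "t \<in> {-T..T}"
    show "GDERIV (\<lambda>x. V t x + inner (f t) x) x :> gradient (V t) x + f t"
      using dV[OF t] gV[OF t] by (auto intro!: GDERIV_add GDERIV_inner_right)
  next
    fix r :: real
    let ?C = "{-T..T} \<times> cball (0::'a) r"
    have C: "compact ?C" by (intro compact_Times) auto
    have "bounded ((\<lambda>p. V (fst p) (snd p)) ` ?C)" "bounded ((\<lambda>p. gradient (V (fst p)) (snd p)) ` ?C)"
      by (intro compact_imp_bounded compact_continuous_image C continuous_on_subset[OF cV]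
          continuous_on_subset[OF cgV]; auto)+
    then obtain B1 B2 where B: "\<forall>p\<in>?C. norm (V (fst p) (snd p)) \<le> B1"
        "\<forall>p\<in>?C. norm (gradient (V (fst p)) (snd p)) \<le> B2"
      unfolding bounded_iff ball_simps(9) by blast
    \<comment> \<open>One majorant has to serve both bounds: the absolute values keep each summand
      nonnegative, and \<open>\<bar>r\<bar> + 1\<close> makes the last one dominate
      \<open>norm (f t)\<close> on its own.\<close>
    show "\<exists>k. integrable M k \<and> (\<forall>t\<in>{-T..T}. \<forall>x. norm x \<le> r \<longrightarrow>
        \<bar>V t x + inner (f t) x\<bar> \<le> k t \<and> norm (gradient (V t) x + f t) \<le> k t)"
    proof (intro exI[of _ "\<lambda>t. \<bar>B1\<bar> + \<bar>B2\<bar> + norm (f t) * (\<bar>r\<bar> + 1)"] conjI ballI allI impI)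
      show "integrable M (\<lambda>t. \<bar>B1\<bar> + \<bar>B2\<bar> + norm (f t) * (\<bar>r\<bar> + 1))"
        using fi by auto
      fix t x assume tx: "t \<in> {-T..T}" "norm (x :: 'a) \<le> r"
      have b: "\<bar>V t x\<bar> \<le> B1" "norm (gradient (V t) x) \<le> B2"
        using B(1)[rule_format, of "(t, x)"] B(2)[rule_format, of "(t, x)"] tx by auto
      have "\<bar>inner (f t) x\<bar> \<le> norm (f t) * norm x"
        by (rule Cauchy_Schwarz_ineq2)
      also have "\<dots> \<le> norm (f t) * (\<bar>r\<bar> + 1)"
        using tx by (intro mult_left_mono) auto
      finally show "\<bar>V t x + inner (f t) x\<bar> \<le> \<bar>B1\<bar> + \<bar>B2\<bar> + norm (f t) * (\<bar>r\<bar> + 1)"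
        using b by linarith
      have "norm (f t) * 1 \<le> norm (f t) * (\<bar>r\<bar> + 1)"
        by (intro mult_left_mono) auto
      then show "norm (gradient (V t) x + f t) \<le> \<bar>B1\<bar> + \<bar>B2\<bar> + norm (f t) * (\<bar>r\<bar> + 1)"
        using b norm_triangle_ineq[of "gradient (V t) x" "f t"] by linarith
    qed
  qed
qed

theorem theorem1p1:
  fixes T b \<rho>\<^sub>0 b\<^sub>1 p \<nu> \<mu> C \<rho> :: real
    and G :: "real ^ 'n \<Rightarrow> real"
    and V K W :: "real \<Rightarrow> real ^ 'n \<Rightarrow> real"
    and L :: "real \<Rightarrow> real ^ 'n \<Rightarrow> real ^ 'n \<Rightarrow> real"
    and a \<kappa> :: "real \<Rightarrow> real"
    and f :: "real \<Rightarrow> real ^ 'n"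
  assumes T: "T > 0"
    and L: "\<And>t x v. t \<in> {-T..T} \<Longrightarrow> L t x v = G v + V t x + inner (f t) x"
    and A1: "G_function G" "C1_on UNIV G" "Delta2 G" "Nabla2 G"
    and A2: "\<And>t x. t \<in> {-T..T} \<Longrightarrow> V t x = K t x - W t x"
      "C1_on ({-T..T} \<times> UNIV) (\<lambda>(t, x). K t x)"
      "C1_on ({-T..T} \<times> UNIV) (\<lambda>(t, x). W t x)"
    and A3: "integrable (lebesgue_on {-T..T}) a" "b > 1" "\<rho>\<^sub>0 > 0"
      "\<And>t x. t \<in> {-T..T} \<Longrightarrow> norm x \<le> \<rho>\<^sub>0 \<Longrightarrow> V t x \<ge> b * G x - a t"
    and A4: "b\<^sub>1 > 0" "p > 1" "(\<lambda>x :: real ^ 'n. norm x powr p) \<prec>\<^sub>G G"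
      "\<And>\<epsilon>. \<epsilon> > 0 \<Longrightarrow> \<exists>r>0. \<forall>t\<in>{-T..T}. \<forall>x. norm x > r \<longrightarrow>
         K t x \<ge> (b\<^sub>1 - \<epsilon>) * norm x powr p"
      "\<exists>\<epsilon>\<^sub>0>0. \<exists>r>0. \<forall>t\<in>{-T..T}. \<forall>x. norm x > r \<longrightarrow>
         W t x \<ge> (3 + \<epsilon>\<^sub>0) * max (K t x) (G x)"
    and A5: "\<mu> > q_index_inf G + \<nu>"
      "integrable (lebesgue_on {-T..T}) \<kappa>" "\<And>t. t \<in> {-T..T} \<Longrightarrow> \<kappa> t \<ge> 0"
      "\<And>t x. t \<in> {-T..T} \<Longrightarrow>
         inner (gradient (V t) x) x \<le> (q_index_inf G + \<nu>) * K t x - \<mu> * W t x + \<kappa> t"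
    and A6: "(LINT t|lebesgue_on {-T..T}. V t 0) = 0"
    and A7: "f \<in> orlicz_space T (fenchel_conjugate G)"
    and C: "embedding_constant T G C"
    and \<rho>: "\<rho> = \<rho>\<^sub>0 / C"
    and global: "Delta2_global G" "Nabla2_global G"
    and small: "modular T (fenchel_conjugate G) f + (LINT t|lebesgue_on {-T..T}. a t)
      < min 1 (b - 1) *
        (if \<rho> \<le> 2 then (\<rho> / 2) powr q_index G else (\<rho> / 2) powr p_index G)"
  shows "\<exists>u\<in>orlicz_sobolev T G.
    ae_time_derivative T (\<lambda>t. gradient (\<lambda>v. L t (u t) v) (vel u t))
      (\<lambda>t. gradient (\<lambda>x. L t x (vel u t)) (u t)) \<and>
    ae_time_derivative T (\<lambda>t. gradient G (vel u t)) (\<lambda>t. gradient (V t) (u t) + f t) \<and>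
    u (-T) = u T"
proof -
  interpret orlicz_setting T G
    using T A1 global by unfold_locales
  interpret action_setting T G "\<lambda>t x. V t x + inner (f t) x" "\<lambda>t x. gradient (V t) x + f t"
    by (rule action_setting_potential[OF A2 A7])
  define c where "c = (if \<rho> \<le> 2 then (\<rho> / 2) powr q_index G else (\<rho> / 2) powr p_index G)"
  define m where "m = min 1 (b - 1)"
  have C0: "C > 0" using C by (simp add: embedding_constant_def)
  have \<rho>0: "\<rho> > 0" using C0 A3 \<rho> by simp
  have c0: "c > 0" using \<rho>0 by (auto simp: c_def)
  have m: "m > 0" "m \<le> 1" "m \<le> b - 1" using A3(2) by (auto simp: m_def)
  \<comment> \<open>The dilation factor is \<open>2 / \<rho>\<close>. It is at least 1 for
    \<open>\<rho> \<le> 2\<close>, where the upper index applies, and below 1 otherwise, where the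
    lower index applies.\<close>
  have scale: "G (x /\<^sub>R (\<rho> / 2)) \<le> G x / c" for x
  proof (cases "\<rho> \<le> 2")
    case True
    have "G (x /\<^sub>R (\<rho> / 2)) \<le> inverse (\<rho> / 2) powr q_index G * G x"
      using True \<rho>0 by (intro G_scale_q) (simp add: field_simps)
    then show ?thesis
      using True \<rho>0 by (simp add: c_def powr_divide field_simps inverse_powr)
  next
    case False
    have "G (x /\<^sub>R (\<rho> / 2)) \<le> inverse (\<rho> / 2) powr p_index G * G x"
      using False \<rho>0 by (intro G_scale_p) (simp_all add: field_simps)
    then show ?thesis
      using False \<rho>0 by (simp add: c_def powr_divide field_simps inverse_powr)
  qed
  \<comment> \<open>This is what makes (A3) available along every competitor: two norms of at most
    \<open>\<rho> / 2\<close> and the constant \<open>C\<close> give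
    \<open>C * \<rho> = \<rho>\<^sub>0\<close>.\<close>
  have sup: "norm (curve x g t) \<le> \<rho>\<^sub>0" if "admissible x g" "energy x g \<le> c" "t \<in> {-T..T}" for x g t
  proof -
    have "norm (curve x g t) \<le> C * (2 * (\<rho> / 2))"
      using that c0 \<rho>0 scale C by (intro admissible_sup_bound) auto
    also have "\<dots> = \<rho>\<^sub>0" using C0 by (simp add: \<rho>)
    finally show ?thesis .
  qed
  obtain x g where adm: "admissible x g" and en: "energy x g \<le> c"
    and min: "\<And>y h. admissible y h \<Longrightarrow> energy y h \<le> c \<Longrightarrow> action x g \<le> action y h"
    using exists_minimizer[OF less_imp_le[OF c0] sup] by blast
  note g = admissibleD[OF adm]
  let ?u = "curve x g"
  have u: "continuous_on {-T..T} ?u"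
    using g by (intro curve_continuous)
  have f: "f \<in> borel_measurable M" "integrable M (\<lambda>t. Gstar (f t))"
    using A7 by (auto simp: orlicz_space_iff)
  \<comment> \<open>The zero curve is a competitor, and its action is the integral in (A6).\<close>
  have "action x g \<le> action 0 (\<lambda>_. 0)"
    using c0 by (intro min) (auto simp: admissible_def energy_def curve_def)
  also have "\<dots> = 0"
    using A6 by (simp add: action_def curve_def)
  finally have "(LINT t|M. V t (?u t) + inner (f t) (?u t)) \<le> - (LINT t|M. G (g t))"
    by (simp add: action_def)
  moreover have "(LINT t|M. (b - 1) * G (?u t) - a t - Gstar (f t)) \<le> (LINT t|M. V t (?u t) + inner (f t) (?u t))"
  proof (rule integral_mono)
    show "integrable M (\<lambda>t. (b - 1) * G (?u t) - a t - Gstar (f t))"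
      using integrable_G_continuous[OF u] f A3(1) by auto
    show "integrable M (\<lambda>t. V t (?u t) + inner (f t) (?u t))"
      by (rule integrable_F(1)[OF u])
    fix t assume "t \<in> space M"
    then have t: "t \<in> {-T..T}" by simp
    have "V t (?u t) \<ge> b * G (?u t) - a t"
      using A3(4)[OF t] sup[OF adm en t] by blast
    \<comment> \<open>Young's inequality at minus the curve; evenness of \<open>G\<close> removes
      the sign. It uses up one unit of the coefficient \<open>b\<close>.\<close>
    moreover have "- inner (f t) (?u t) \<le> G (?u t) + Gstar (f t)"
      using fenchel_young[of "- ?u t" "f t"] by (simp add: inner_commute)
    ultimately show "(b - 1) * G (?u t) - a t - Gstar (f t) \<le> V t (?u t) + inner (f t) (?u t)"
      by (simp add: algebra_simps)
  qed
  moreover have "(LINT t|M. (b - 1) * G (?u t) - a t - Gstar (f t))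
      = (b - 1) * (LINT t|M. G (?u t)) - (LINT t|M. a t) - modular T Gstar f"
    using integrable_G_continuous[OF u] f A3(1) by (simp add: modular_def)
  ultimately have "(b - 1) * (LINT t|M. G (?u t)) + (LINT t|M. G (g t))
      \<le> modular T Gstar f + (LINT t|M. a t)"
    by linarith
  also have "\<dots> < m * c"
    using small by (simp add: m_def c_def)
  finally have "(b - 1) * (LINT t|M. G (?u t)) + (LINT t|M. G (g t)) < m * c" .
  \<comment> \<open>Nonnegative modulars allow both coefficients, \<open>b - 1\<close> and 1, to be
    lowered to their minimum \<open>m\<close>, which then cancels.\<close>
  moreover have "(LINT t|M. G (h t)) \<ge> 0" for h
    by (intro integral_nonneg_AE AE_I2 G_nonneg)
  then have "m * (LINT t|M. G (?u t)) \<le> (b - 1) * (LINT t|M. G (?u t))"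
    "m * (LINT t|M. G (g t)) \<le> 1 * (LINT t|M. G (g t))"
    using m(2,3) mult_right_mono by blast+
  ultimately have "m * energy x g < m * c"
    by (simp add: energy_def distrib_left)
  then have en': "energy x g < c"
    using m by simp
  have EL: "ae_time_derivative T (\<lambda>t. gradient G (vel ?u t)) (\<lambda>t. gradient (V t) (?u t) + f t)"
    by (rule minimizer_solves[OF adm en' min])
  have "ae_time_derivative T (\<lambda>t. gradient (\<lambda>v. L t (?u t) v) (vel ?u t))
      (\<lambda>t. gradient (\<lambda>x. L t x (vel ?u t)) (?u t))"
  \<comment> \<open>At fixed time each partial function of \<open>L\<close> differs from
    \<open>G\<close>, or from the potential with the force, by a constant.\<close>
  proof (rule ae_time_derivative_cong[OF _ _ EL])
    fix t assume t: "t \<in> {-T..T}"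
    have "(\<lambda>v. L t (?u t) v) = (\<lambda>v. G v + (V t (?u t) + inner (f t) (?u t)))"
      using L[OF t] by (simp add: add.assoc)
    then show "gradient G (vel ?u t) = gradient (\<lambda>v. L t (?u t) v) (vel ?u t)"
      by (simp only: gradient_add_const)
    have "(\<lambda>x. L t x (vel ?u t)) = (\<lambda>x. (V t x + inner (f t) x) + G (vel ?u t))"
      using L[OF t] by (simp add: algebra_simps)
    then show "gradient (V t) (?u t) + f t = gradient (\<lambda>x. L t x (vel ?u t)) (?u t)"
      using gradient_eqI[OF F_GDERIV[OF t]] by (simp only: gradient_add_const)
  qed
  moreover have "?u \<in> orlicz_sobolev T G"
    by (rule admissible_orlicz_sobolev[OF adm])
  ultimately show ?thesis
    using EL by (intro bexI[of _ ?u]) (auto simp: orlicz_sobolev_def)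
qed

end
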